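(* Let $X_1,\ldots,X_n$ and $Y$ be Banach spaces and let $T:X_1\times\cdots\times X_n\to Y$ be a multilinear mapping. Let $\hat T:X_1\otimes\cdots\otimes X_n\to Y$ be the unique linear map with $\hat T(x_1\otimes\cdots\otimes x_n)=T(x_1,\ldots,x_n)$ for all $x_i\in X_i$, and let $f_T:=\hat T|_{\Sigma_{X_1,\ldots,X_n}}$. Then the following statements are equivalent: i) $T$ is bounded. ii) $\hat T$ is bounded with respect to the projective norm $\pi$, i.e. it defines a bounded linear operator $\hat T\in\mathcal{L}(X_1\hat\otimes_\pi\cdots\hat\otimes_\pi X_n;Y)$. iii) $f_T:(\Sigma_{X_1,\ldots,X_n},d_\pi)\to Y$ is Lipschitz. In this case, $\|T\|=\|\hat T\|=\|f_T\|_{Lip}$.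
   Context: Banach spaces are over the same field $\mathbb{R}$ or $\mathbb{C}$. $\Sigma_{X_1,\ldots,X_n}=\{x_1\otimes\cdots\otimes x_n: x_i\in X_i\}$ is the set of decomposable tensors in the algebraic tensor product $X_1\otimes\cdots\otimes X_n$. $\pi(z)=\inf\{\sum_i\|x_1^i\|\cdots\|x_n^i\|: z=\sum_i x_1^i\otimes\cdots\otimes x_n^i\}$ is the projective norm, $X_1\hat\otimes_\pi\cdots\hat\otimes_\pi X_n$ is the completion of $(X_1\otimes\cdots\otimes X_n,\pi)$, and $d_\pi(w,z)=\pi(w-z)$. $\|T\|=\sup\{\|T(x_1,\ldots,x_n)\|:\|x_i\|\le1\}$ ($T$ is bounded if this is finite), $\|\hat T\|$ is the operator norm with respect to $\pi$, and $\|f_T\|_{Lip}$ is the least Lipschitz constant of $f_T$ with respect to $d_\pi$ and the norm of $Y$. *)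

theory Defs
  imports "HOL-Analysis.Analysis" "HOL-Library.Poly_Mapping"
begin

text \<open>
  The spaces \<open>X\<^sub>1, \<dots>, X\<^sub>n\<close> are distinct Banach spaces and \<open>n\<close> varies, so spaces are
  modelled by explicit carriers and operations rather than by type classes. This loses no
  generality: the carriers of finitely many spaces can be placed in one common type
  without changing their structure.

  Scalars range over a type of class \<^class>\<open>real_normed_field\<close>. Its norm is multiplicative and it
  is an algebra over the reals, so by Gelfand--Mazur every such type is
  isometrically isomorphic to \<^typ>\<open>real\<close> or \<^typ>\<open>complex\<close>; both are instances.
\<close>

record ('k, 'a) vspace =
  vcarrier :: "'a set"
  vadd :: "'a \<Rightarrow> 'a \<Rightarrow> 'a"
  vzero :: 'a
  vscale :: "'k \<Rightarrow> 'a \<Rightarrow> 'a"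

record ('k, 'a) nspace = "('k, 'a) vspace" +
  vnorm :: "'a \<Rightarrow> real"

definition vdiff :: "('k::field, 'a, 'm) vspace_scheme \<Rightarrow> 'a \<Rightarrow> 'a \<Rightarrow> 'a" where
  "vdiff V x y = vadd V x (vscale V (- 1) y)"

definition vsum_list :: "('k, 'a, 'm) vspace_scheme \<Rightarrow> 'a list \<Rightarrow> 'a" where
  "vsum_list V xs = foldr (vadd V) xs (vzero V)"

definition norm_dist :: "('k::field, 'a, 'm) nspace_scheme \<Rightarrow> 'a \<Rightarrow> 'a \<Rightarrow> real" where
  "norm_dist V x y = vnorm V (vdiff V x y)"

definition cauchy_seqs :: "('k::field, 'a, 'm) nspace_scheme \<Rightarrow> (nat \<Rightarrow> 'a) set" where
  "cauchy_seqs V = {s. range s \<subseteq> vcarrier V \<and>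
     (\<forall>e>0. \<exists>N. \<forall>j\<ge>N. \<forall>k\<ge>N. norm_dist V (s j) (s k) < e)}"

locale carrier_vector_space =
  fixes V :: "('k::field, 'a, 'm) vspace_scheme"
  assumes zero_closed: "vzero V \<in> vcarrier V"
    and add_closed: "\<lbrakk>x \<in> vcarrier V; y \<in> vcarrier V\<rbrakk> \<Longrightarrow> vadd V x y \<in> vcarrier V"
    and scale_closed: "x \<in> vcarrier V \<Longrightarrow> vscale V c x \<in> vcarrier V"
    and add_assoc: "\<lbrakk>x \<in> vcarrier V; y \<in> vcarrier V; z \<in> vcarrier V\<rbrakk>
        \<Longrightarrow> vadd V (vadd V x y) z = vadd V x (vadd V y z)"
    and add_commute: "\<lbrakk>x \<in> vcarrier V; y \<in> vcarrier V\<rbrakk> \<Longrightarrow> vadd V x y = vadd V y x"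
    and add_zero: "x \<in> vcarrier V \<Longrightarrow> vadd V (vzero V) x = x"
    and add_inverse: "x \<in> vcarrier V \<Longrightarrow> \<exists>y\<in>vcarrier V. vadd V x y = vzero V"
    and scale_add_right: "\<lbrakk>x \<in> vcarrier V; y \<in> vcarrier V\<rbrakk>
        \<Longrightarrow> vscale V c (vadd V x y) = vadd V (vscale V c x) (vscale V c y)"
    and scale_add_left: "x \<in> vcarrier V
        \<Longrightarrow> vscale V (c + d) x = vadd V (vscale V c x) (vscale V d x)"
    and scale_scale: "x \<in> vcarrier V \<Longrightarrow> vscale V c (vscale V d x) = vscale V (c * d) x"
    and scale_one: "x \<in> vcarrier V \<Longrightarrow> vscale V 1 x = x"

locale carrier_normed_space = carrier_vector_space V
  for V :: "('k::real_normed_field, 'a, 'm) nspace_scheme" +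
  assumes norm_nonneg: "x \<in> vcarrier V \<Longrightarrow> 0 \<le> vnorm V x"
    and norm_eq_zero_iff: "x \<in> vcarrier V \<Longrightarrow> vnorm V x = 0 \<longleftrightarrow> x = vzero V"
    and norm_scale: "x \<in> vcarrier V \<Longrightarrow> vnorm V (vscale V c x) = norm c * vnorm V x"
    and norm_triangle: "\<lbrakk>x \<in> vcarrier V; y \<in> vcarrier V\<rbrakk>
        \<Longrightarrow> vnorm V (vadd V x y) \<le> vnorm V x + vnorm V y"

locale carrier_banach_space = carrier_normed_space +
  assumes complete: "s \<in> cauchy_seqs V
      \<Longrightarrow> \<exists>l\<in>vcarrier V. (\<lambda>k. norm_dist V (s k) l) \<longlonglongrightarrow> 0"

text \<open>
  Linear maps are taken extensional (value \<^const>\<open>undefined\<close> off the carrier), so that a linear map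
  is determined by its values on the carrier.
\<close>

definition linear_map ::
  "('k, 'a, 'm) vspace_scheme \<Rightarrow> ('k, 'b, 'l) vspace_scheme \<Rightarrow> ('a \<Rightarrow> 'b) \<Rightarrow> bool" where
  "linear_map V W f \<longleftrightarrow>
     f \<in> vcarrier V \<rightarrow>\<^sub>E vcarrier W \<and>
     (\<forall>x\<in>vcarrier V. \<forall>y\<in>vcarrier V. f (vadd V x y) = vadd W (f x) (f y)) \<and>
     (\<forall>c. \<forall>x\<in>vcarrier V. f (vscale V c x) = vscale W c (f x))"

definition bounded_linear_map ::
  "('k, 'a, 'm) nspace_scheme \<Rightarrow> ('k, 'b, 'l) nspace_scheme \<Rightarrow> ('a \<Rightarrow> 'b) \<Rightarrow> bool" where
  "bounded_linear_map V W f \<longleftrightarrow>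
     linear_map V W f \<and> (\<exists>C. \<forall>x\<in>vcarrier V. vnorm W (f x) \<le> C * vnorm V x)"

definition operator_norm ::
  "('k, 'a, 'm) nspace_scheme \<Rightarrow> ('k, 'b, 'l) nspace_scheme \<Rightarrow> ('a \<Rightarrow> 'b) \<Rightarrow> real" where
  "operator_norm V W f = (SUP x\<in>{x \<in> vcarrier V. vnorm V x \<le> 1}. vnorm W (f x))"

definition lipschitz_const ::
  "'a set \<Rightarrow> ('a \<Rightarrow> 'a \<Rightarrow> real) \<Rightarrow> ('b \<Rightarrow> 'b \<Rightarrow> real) \<Rightarrow> ('a \<Rightarrow> 'b) \<Rightarrow> real \<Rightarrow> bool" where
  "lipschitz_const S d e f L \<longleftrightarrow> 0 \<le> L \<and> (\<forall>w\<in>S. \<forall>z\<in>S. e (f w) (f z) \<le> L * d w z)"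

definition lipschitz_norm ::
  "'a set \<Rightarrow> ('a \<Rightarrow> 'a \<Rightarrow> real) \<Rightarrow> ('b \<Rightarrow> 'b \<Rightarrow> real) \<Rightarrow> ('a \<Rightarrow> 'b) \<Rightarrow> real" where
  "lipschitz_norm S d e f = (LEAST L. lipschitz_const S d e f L)"


subsection \<open>Multilinear maps\<close>

definition tuples :: "nat \<Rightarrow> (nat \<Rightarrow> ('k, 'a, 'm) vspace_scheme) \<Rightarrow> (nat \<Rightarrow> 'a) set" where
  "tuples n X = (\<Pi>\<^sub>E i\<in>{1..n}. vcarrier (X i))"

definition multilinear_map ::
  "nat \<Rightarrow> (nat \<Rightarrow> ('k, 'a, 'm) vspace_scheme) \<Rightarrow> ('k, 'b, 'l) vspace_scheme
    \<Rightarrow> ((nat \<Rightarrow> 'a) \<Rightarrow> 'b) \<Rightarrow> bool" where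
  "multilinear_map n X Y T \<longleftrightarrow>
     T \<in> tuples n X \<rightarrow> vcarrier Y \<and>
     (\<forall>x\<in>tuples n X. \<forall>i\<in>{1..n}. \<forall>u\<in>vcarrier (X i). \<forall>v\<in>vcarrier (X i).
        T (x(i := vadd (X i) u v)) = vadd Y (T (x(i := u))) (T (x(i := v)))) \<and>
     (\<forall>x\<in>tuples n X. \<forall>i\<in>{1..n}. \<forall>c. \<forall>u\<in>vcarrier (X i).
        T (x(i := vscale (X i) c u)) = vscale Y c (T (x(i := u))))"

definition unit_tuples :: "nat \<Rightarrow> (nat \<Rightarrow> ('k, 'a, 'm) nspace_scheme) \<Rightarrow> (nat \<Rightarrow> 'a) set" where
  "unit_tuples n X = {x \<in> tuples n X. \<forall>i\<in>{1..n}. vnorm (X i) (x i) \<le> 1}"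

definition bounded_multilinear_map ::
  "nat \<Rightarrow> (nat \<Rightarrow> ('k, 'a, 'm) nspace_scheme) \<Rightarrow> ('k, 'b, 'l) nspace_scheme
    \<Rightarrow> ((nat \<Rightarrow> 'a) \<Rightarrow> 'b) \<Rightarrow> bool" where
  "bounded_multilinear_map n X Y T \<longleftrightarrow>
     multilinear_map n X Y T \<and> bdd_above ((\<lambda>x. vnorm Y (T x)) ` unit_tuples n X)"

definition multilinear_norm ::
  "nat \<Rightarrow> (nat \<Rightarrow> ('k, 'a, 'm) nspace_scheme) \<Rightarrow> ('k, 'b, 'l) nspace_scheme
    \<Rightarrow> ((nat \<Rightarrow> 'a) \<Rightarrow> 'b) \<Rightarrow> real" where
  "multilinear_norm n X Y T = (SUP x\<in>unit_tuples n X. vnorm Y (T x))"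


subsection \<open>The algebraic tensor product\<close>

text \<open>
  The free vector space on the set of tuples, modulo the subspace spanned by the
  multilinearity relations.
\<close>

definition free_scale :: "'k::field \<Rightarrow> ('b \<Rightarrow>\<^sub>0 'k) \<Rightarrow> ('b \<Rightarrow>\<^sub>0 'k)" where
  "free_scale c f = Poly_Mapping.map ((*) c) f"

definition free_space ::
  "nat \<Rightarrow> (nat \<Rightarrow> ('k::field, 'a, 'm) vspace_scheme) \<Rightarrow> ((nat \<Rightarrow> 'a) \<Rightarrow>\<^sub>0 'k) set" where
  "free_space n X = {f. Poly_Mapping.keys f \<subseteq> tuples n X}"

definition multilinear_relations ::
  "nat \<Rightarrow> (nat \<Rightarrow> ('k::field, 'a, 'm) vspace_scheme) \<Rightarrow> ((nat \<Rightarrow> 'a) \<Rightarrow>\<^sub>0 'k) set" where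
  "multilinear_relations n X =
     {Poly_Mapping.single (x(i := vadd (X i) u v)) 1
        - Poly_Mapping.single (x(i := u)) 1 - Poly_Mapping.single (x(i := v)) 1 | x i u v.
        x \<in> tuples n X \<and> i \<in> {1..n} \<and> u \<in> vcarrier (X i) \<and> v \<in> vcarrier (X i)} \<union>
     {Poly_Mapping.single (x(i := vscale (X i) c u)) 1
        - free_scale c (Poly_Mapping.single (x(i := u)) 1) | x i c u.
        x \<in> tuples n X \<and> i \<in> {1..n} \<and> u \<in> vcarrier (X i)}"

definition tensor_rel ::
  "nat \<Rightarrow> (nat \<Rightarrow> ('k::field, 'a, 'm) vspace_scheme)
    \<Rightarrow> (((nat \<Rightarrow> 'a) \<Rightarrow>\<^sub>0 'k) \<times> ((nat \<Rightarrow> 'a) \<Rightarrow>\<^sub>0 'k)) set" where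
  "tensor_rel n X = {(f, g). f \<in> free_space n X \<and> g \<in> free_space n X \<and>
     f - g \<in> module.span free_scale (multilinear_relations n X)}"

definition alg_tensor ::
  "nat \<Rightarrow> (nat \<Rightarrow> ('k::field, 'a, 'm) vspace_scheme)
    \<Rightarrow> ('k, ((nat \<Rightarrow> 'a) \<Rightarrow>\<^sub>0 'k) set) vspace" where
  "alg_tensor n X =
     \<lparr>vcarrier = free_space n X // tensor_rel n X,
      vadd = (\<lambda>A B. \<Union>f\<in>A. \<Union>g\<in>B. tensor_rel n X `` {f + g}),
      vzero = tensor_rel n X `` {0},
      vscale = (\<lambda>c A. \<Union>f\<in>A. tensor_rel n X `` {free_scale c f})\<rparr>"

definition tensor ::
  "nat \<Rightarrow> (nat \<Rightarrow> ('k::field, 'a, 'm) vspace_scheme) \<Rightarrow> (nat \<Rightarrow> 'a)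
    \<Rightarrow> ((nat \<Rightarrow> 'a) \<Rightarrow>\<^sub>0 'k) set" where
  "tensor n X x = tensor_rel n X `` {Poly_Mapping.single x 1}"

definition decomposable_tensors ::
  "nat \<Rightarrow> (nat \<Rightarrow> ('k::field, 'a, 'm) vspace_scheme) \<Rightarrow> ((nat \<Rightarrow> 'a) \<Rightarrow>\<^sub>0 'k) set set" where
  "decomposable_tensors n X = tensor n X ` tuples n X"

definition linearization ::
  "nat \<Rightarrow> (nat \<Rightarrow> ('k::field, 'a, 'm) vspace_scheme) \<Rightarrow> ('k, 'b, 'l) vspace_scheme
    \<Rightarrow> ((nat \<Rightarrow> 'a) \<Rightarrow> 'b) \<Rightarrow> ((nat \<Rightarrow> 'a) \<Rightarrow>\<^sub>0 'k) set \<Rightarrow> 'b" where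
  "linearization n X Y T =
     (THE F. linear_map (alg_tensor n X) Y F \<and> (\<forall>x\<in>tuples n X. F (tensor n X x) = T x))"

definition decomposable_restriction ::
  "nat \<Rightarrow> (nat \<Rightarrow> ('k::field, 'a, 'm) vspace_scheme) \<Rightarrow> ('k, 'b, 'l) vspace_scheme
    \<Rightarrow> ((nat \<Rightarrow> 'a) \<Rightarrow> 'b) \<Rightarrow> ((nat \<Rightarrow> 'a) \<Rightarrow>\<^sub>0 'k) set \<Rightarrow> 'b" where
  "decomposable_restriction n X Y T =
     restrict (linearization n X Y T) (decomposable_tensors n X)"


subsection \<open>The projective norm and completion\<close>

definition projective_norm ::
  "nat \<Rightarrow> (nat \<Rightarrow> ('k::field, 'a, 'm) nspace_scheme) \<Rightarrow> ((nat \<Rightarrow> 'a) \<Rightarrow>\<^sub>0 'k) set \<Rightarrow> real" where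
  "projective_norm n X z =
     Inf {(\<Sum>x\<leftarrow>xs. \<Prod>i=1..n. vnorm (X i) (x i)) | xs.
       set xs \<subseteq> tuples n X \<and> z = vsum_list (alg_tensor n X) (map (tensor n X) xs)}"

definition projective_tensor ::
  "nat \<Rightarrow> (nat \<Rightarrow> ('k::field, 'a, 'm) nspace_scheme)
    \<Rightarrow> ('k, ((nat \<Rightarrow> 'a) \<Rightarrow>\<^sub>0 'k) set) nspace" where
  "projective_tensor n X =
     vspace.extend (alg_tensor n X) (nspace.fields (projective_norm n X))"

definition null_rel :: "('k::field, 'a, 'm) nspace_scheme \<Rightarrow> ((nat \<Rightarrow> 'a) \<times> (nat \<Rightarrow> 'a)) set" where
  "null_rel V = {(s, t). s \<in> cauchy_seqs V \<and> t \<in> cauchy_seqs V \<and>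
     (\<lambda>k. norm_dist V (s k) (t k)) \<longlonglongrightarrow> 0}"

definition norm_completion ::
  "('k::field, 'a, 'm) nspace_scheme \<Rightarrow> ('k, (nat \<Rightarrow> 'a) set) nspace" where
  "norm_completion V =
     \<lparr>vcarrier = cauchy_seqs V // null_rel V,
      vadd = (\<lambda>A B. \<Union>s\<in>A. \<Union>t\<in>B. null_rel V `` {\<lambda>k. vadd V (s k) (t k)}),
      vzero = null_rel V `` {\<lambda>_. vzero V},
      vscale = (\<lambda>c A. \<Union>s\<in>A. null_rel V `` {\<lambda>k. vscale V c (s k)}),
      vnorm = (\<lambda>A. THE l. \<forall>s\<in>A. (\<lambda>k. vnorm V (s k)) \<longlonglongrightarrow> l)\<rparr>"

definition completion_embed :: "('k::field, 'a, 'm) nspace_scheme \<Rightarrow> 'a \<Rightarrow> (nat \<Rightarrow> 'a) set" where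
  "completion_embed V z = null_rel V `` {\<lambda>_. z}"

definition extends_to_completion ::
  "('k::field, 'a, 'm) nspace_scheme \<Rightarrow> ('a \<Rightarrow> 'b) \<Rightarrow> ((nat \<Rightarrow> 'a) set \<Rightarrow> 'b) \<Rightarrow> bool" where
  "extends_to_completion V f F \<longleftrightarrow> (\<forall>z\<in>vcarrier V. F (completion_embed V z) = f z)"

end

theory Submission imports Defs "HOL-Algebra.FiniteProduct" begin

text \<open>
  Rescaling each factor gives \<open>\<parallel>T x\<parallel> \<le> \<parallel>T\<parallel> \<Prod>\<^sub>i \<parallel>x\<^sub>i\<parallel>\<close>; summing this over a representation of \<open>z\<close>
  and taking the infimum gives \<open>\<parallel>T_hat z\<parallel> \<le> \<parallel>T\<parallel> \<pi>(z)\<close>. Linearity turns this into a Lipschitz bound, and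
  comparing a decomposable tensor with the zero tensor, where \<open>\<pi>(x\<^sub>1 \<otimes> \<dots> \<otimes> x\<^sub>n) \<le> \<Prod>\<^sub>i \<parallel>x\<^sub>i\<parallel>\<close>, leads back
  to \<open>T\<close> with the same constant. That \<open>\<pi>\<close> is a seminorm suffices throughout: bounded maps into a
  Banach space extend to the completion of any seminormed space with the same norm.
\<close>

section \<open>Vector spaces with a seminorm\<close>

text \<open>Two obstacles shape the development. First, \<open>linearization\<close> is a definite
  description, so nothing can be said about it before existence and uniqueness are both known.
  Existence comes from the free space: the linear extension of \<open>T\<close> from the tuples
  kills the multilinearity relations and hence their span. Uniqueness comes from absorbing
  coefficients: as \<open>n \<ge> 1\<close>, a scalar can be moved into the first factor, so every
  tensor is a plain sum of decomposable ones. The same fact makes the set of costs in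
  \<open>projective_norm\<close> nonempty, without which its infimum would carry no information.
  Second, definiteness of the projective norm is usually proved by separating tensors with
  functionals; seminorms avoid that argument. The quotient by \<open>null_rel\<close> merges vectors
  at distance zero, and a bounded linear map into \<open>Y\<close> cannot tell them apart, because
  the norm of \<open>Y\<close> is definite. Finally, \<open>LEAST\<close> over the reals only makes
  sense for an attained minimum; the operator norm turns out to attain it.\<close>

context carrier_vector_space
begin

lemma add_zero_right: "x \<in> vcarrier V \<Longrightarrow> vadd V x (vzero V) = x"
  by (metis add_commute add_zero zero_closed)

lemma add_swap:
  assumes "a \<in> vcarrier V" "b \<in> vcarrier V" "c \<in> vcarrier V" "d \<in> vcarrier V"
  shows "vadd V (vadd V a b) (vadd V c d) = vadd V (vadd V a c) (vadd V b d)"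
proof -
  have "vadd V b (vadd V c d) = vadd V c (vadd V b d)"
    using assms add_commute[of b c] by (simp flip: add_assoc)
  then show ?thesis
    using assms by (simp add: add_assoc add_closed)
qed

lemma scale_zero_left:
  assumes x: "x \<in> vcarrier V"
  shows "vscale V 0 x = vzero V"
proof -
  obtain y where y: "y \<in> vcarrier V" "vadd V x y = vzero V"
    using add_inverse x by blast
  have "vadd V x (vscale V 0 x) = x"
    using scale_add_left[OF x, of 1 0] x by (simp add: scale_one)
  then have "vadd V (vadd V y x) (vscale V 0 x) = vadd V y x"
    using x y by (simp add: add_assoc scale_closed)
  then show ?thesis
    using x y by (metis add_commute add_zero scale_closed)
qed

lemma scale_zero_right: "vscale V c (vzero V) = vzero V"
  by (metis mult_zero_right scale_scale scale_zero_left zero_closed)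

lemma diff_closed: "\<lbrakk>x \<in> vcarrier V; y \<in> vcarrier V\<rbrakk> \<Longrightarrow> vdiff V x y \<in> vcarrier V"
  by (simp add: vdiff_def add_closed scale_closed)

lemma add_neg_self: "x \<in> vcarrier V \<Longrightarrow> vadd V x (vscale V (- 1) x) = vzero V"
  using scale_add_left[of x 1 "- 1"] by (simp add: scale_one scale_zero_left)

lemma diff_self: "x \<in> vcarrier V \<Longrightarrow> vdiff V x x = vzero V"
  by (simp add: vdiff_def add_neg_self)

lemma diff_zero: "x \<in> vcarrier V \<Longrightarrow> vdiff V x (vzero V) = x"
  by (simp add: vdiff_def add_zero_right scale_zero_right)

lemma diff_add_cancel: "\<lbrakk>x \<in> vcarrier V; y \<in> vcarrier V\<rbrakk> \<Longrightarrow> vadd V (vdiff V x y) y = x"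
  by (simp add: vdiff_def add_assoc scale_closed add_commute[of "vscale V (- 1) y" y]
      add_neg_self add_zero_right)

lemma eq_of_diff_zero:
  "\<lbrakk>x \<in> vcarrier V; y \<in> vcarrier V; vdiff V x y = vzero V\<rbrakk> \<Longrightarrow> x = y"
  using diff_add_cancel add_zero by metis

lemma diff_add_add:
  "\<lbrakk>a \<in> vcarrier V; b \<in> vcarrier V; c \<in> vcarrier V; d \<in> vcarrier V\<rbrakk>
    \<Longrightarrow> vdiff V (vadd V a b) (vadd V c d) = vadd V (vdiff V a c) (vdiff V b d)"
  by (simp add: vdiff_def scale_add_right add_swap scale_closed)

lemma diff_scale:
  "\<lbrakk>x \<in> vcarrier V; y \<in> vcarrier V\<rbrakk>
    \<Longrightarrow> vdiff V (vscale V c x) (vscale V c y) = vscale V c (vdiff V x y)"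
  by (simp add: vdiff_def scale_add_right scale_closed scale_scale)

lemma diff_via:
  assumes "x \<in> vcarrier V" "y \<in> vcarrier V" "z \<in> vcarrier V"
  shows "vdiff V x y = vadd V (vdiff V x z) (vdiff V z y)"
proof -
  have "vadd V (vdiff V x z) (vdiff V z y) = vadd V (vadd V (vdiff V x z) z) (vscale V (- 1) y)"
    using assms unfolding vdiff_def[of V z y] by (simp add: add_assoc diff_closed scale_closed)
  then show ?thesis
    using assms by (simp add: diff_add_cancel vdiff_def[of V x y])
qed

lemma diff_swap:
  "\<lbrakk>x \<in> vcarrier V; y \<in> vcarrier V\<rbrakk> \<Longrightarrow> vdiff V y x = vscale V (- 1) (vdiff V x y)"
  by (simp add: vdiff_def scale_add_right scale_closed scale_scale scale_one add_commute)

lemma vsum_list_closed: "set xs \<subseteq> vcarrier V \<Longrightarrow> vsum_list V xs \<in> vcarrier V"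
  by (induction xs) (auto simp: vsum_list_def zero_closed add_closed)

lemma vsum_list_append:
  "\<lbrakk>set xs \<subseteq> vcarrier V; set ys \<subseteq> vcarrier V\<rbrakk>
    \<Longrightarrow> vsum_list V (xs @ ys) = vadd V (vsum_list V xs) (vsum_list V ys)"
proof (induction xs)
  case Nil
  then show ?case
    using add_zero vsum_list_closed[of ys] by (simp add: vsum_list_def)
next
  case (Cons x xs)
  then show ?case
    using add_assoc[of x "vsum_list V xs" "vsum_list V ys"]
      vsum_list_closed[of xs] vsum_list_closed[of ys]
    by (simp add: vsum_list_def)
qed

lemma vsum_list_scale:
  "set xs \<subseteq> vcarrier V \<Longrightarrow> vscale V c (vsum_list V xs) = vsum_list V (map (vscale V c) xs)"
proof (induction xs)
  case Nil
  then show ?case by (simp add: vsum_list_def scale_zero_right)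
next
  case (Cons x xs)
  then show ?case
    using scale_add_right[of x "vsum_list V xs"] vsum_list_closed[of xs]
    by (simp add: vsum_list_def)
qed

text \<open>Carriers are sets, not types, so type-class sums do not apply. Read as a multiplicative
  commutative monoid, a carrier gets its finite sums from \<open>finprod\<close>.\<close>

lemma comm_monoid_add:
  "comm_monoid \<lparr>carrier = vcarrier V, mult = vadd V, one = vzero V\<rparr>"
proof (rule comm_monoidI, goal_cases)
  case (3 x y z)
  then show ?case by (simp add: add_assoc)
next
  case (5 x y)
  then show ?case by (simp add: add_commute)
qed (simp_all add: add_closed zero_closed add_zero)

end

section \<open>Linear maps between carrier spaces\<close>

lemma linear_map_closed: "\<lbrakk>linear_map V W f; x \<in> vcarrier V\<rbrakk> \<Longrightarrow> f x \<in> vcarrier W"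
  by (auto simp: linear_map_def)

lemma linear_map_add:
  "\<lbrakk>linear_map V W f; x \<in> vcarrier V; y \<in> vcarrier V\<rbrakk> \<Longrightarrow> f (vadd V x y) = vadd W (f x) (f y)"
  by (auto simp: linear_map_def)

lemma linear_map_scale:
  "\<lbrakk>linear_map V W f; x \<in> vcarrier V\<rbrakk> \<Longrightarrow> f (vscale V c x) = vscale W c (f x)"
  by (auto simp: linear_map_def)

text \<open>Closure of the scaled vector is a premise instead of a consequence of vector space
  axioms on \<open>V\<close>. This lets the rule apply to \<open>norm_completion V\<close>, where
  closure is checked on representatives.\<close>

lemma linear_map_diff:
  "\<lbrakk>linear_map V W f; x \<in> vcarrier V; y \<in> vcarrier V; vscale V (- 1) y \<in> vcarrier V\<rbrakk>
    \<Longrightarrow> f (vdiff V x y) = vdiff W (f x) (f y)"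
  by (simp add: vdiff_def linear_map_add linear_map_scale)

lemma linear_map_zero:
  assumes "carrier_vector_space V" "carrier_vector_space W" "linear_map V W f"
  shows "f (vzero V) = vzero W"
  using assms
  by (metis carrier_vector_space.scale_zero_left carrier_vector_space.zero_closed
      linear_map_closed linear_map_scale)

lemma linear_map_vsum_list:
  assumes V: "carrier_vector_space V" and W: "carrier_vector_space W"
    and f: "linear_map V W f" and "set xs \<subseteq> vcarrier V"
  shows "f (vsum_list V xs) = vsum_list W (map f xs)"
  using assms(4)
proof (induction xs)
  case Nil
  then show ?case by (simp add: vsum_list_def linear_map_zero[OF V W f])
next
  case (Cons x xs)
  then show ?case
    using linear_map_add[OF f, of x "vsum_list V xs"]
      carrier_vector_space.vsum_list_closed[OF V, of xs]
    by (simp add: vsum_list_def)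
qed

text \<open>The interface under which \<open>projective_tensor n X\<close> enters the theory of
  completions: everything in \<open>carrier_normed_space\<close> except definiteness.\<close>

locale carrier_seminormed_space = carrier_vector_space V
  for V :: "('k::real_normed_field, 'a, 'm) nspace_scheme" +
  assumes seminorm_nonneg: "x \<in> vcarrier V \<Longrightarrow> 0 \<le> vnorm V x"
    and seminorm_scale: "x \<in> vcarrier V \<Longrightarrow> vnorm V (vscale V c x) = norm c * vnorm V x"
    and seminorm_triangle: "\<lbrakk>x \<in> vcarrier V; y \<in> vcarrier V\<rbrakk>
        \<Longrightarrow> vnorm V (vadd V x y) \<le> vnorm V x + vnorm V y"

sublocale carrier_normed_space \<subseteq> carrier_seminormed_space
  by unfold_locales (auto intro: norm_nonneg norm_scale norm_triangle)

context carrier_seminormed_space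
begin

lemma seminorm_zero: "vnorm V (vzero V) = 0"
  using seminorm_scale[OF zero_closed, of 0] by (simp add: scale_zero_left zero_closed)

lemma norm_dist_nonneg: "\<lbrakk>x \<in> vcarrier V; y \<in> vcarrier V\<rbrakk> \<Longrightarrow> 0 \<le> norm_dist V x y"
  by (simp add: norm_dist_def seminorm_nonneg diff_closed)

lemma norm_dist_self: "x \<in> vcarrier V \<Longrightarrow> norm_dist V x x = 0"
  by (simp add: norm_dist_def diff_self seminorm_zero)

lemma norm_dist_zero: "x \<in> vcarrier V \<Longrightarrow> norm_dist V x (vzero V) = vnorm V x"
  by (simp add: norm_dist_def diff_zero)

lemma norm_dist_commute:
  "\<lbrakk>x \<in> vcarrier V; y \<in> vcarrier V\<rbrakk> \<Longrightarrow> norm_dist V x y = norm_dist V y x"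
  using diff_swap[of x y] seminorm_scale[of "vdiff V x y" "- 1"]
  by (simp add: norm_dist_def diff_closed)

lemma norm_dist_triangle:
  "\<lbrakk>x \<in> vcarrier V; y \<in> vcarrier V; z \<in> vcarrier V\<rbrakk>
    \<Longrightarrow> norm_dist V x y \<le> norm_dist V x z + norm_dist V z y"
  using diff_via[of x y z] by (simp add: norm_dist_def seminorm_triangle diff_closed)

lemma norm_dist_add:
  "\<lbrakk>a \<in> vcarrier V; b \<in> vcarrier V; c \<in> vcarrier V; d \<in> vcarrier V\<rbrakk>
    \<Longrightarrow> norm_dist V (vadd V a b) (vadd V c d) \<le> norm_dist V a c + norm_dist V b d"
  by (simp add: norm_dist_def diff_add_add seminorm_triangle diff_closed)

lemma norm_dist_scale:
  "\<lbrakk>x \<in> vcarrier V; y \<in> vcarrier V\<rbrakk>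
    \<Longrightarrow> norm_dist V (vscale V c x) (vscale V c y) = norm c * norm_dist V x y"
  by (simp add: norm_dist_def diff_scale seminorm_scale diff_closed)

lemma abs_norm_diff_le:
  assumes "x \<in> vcarrier V" "y \<in> vcarrier V"
  shows "\<bar>vnorm V x - vnorm V y\<bar> \<le> norm_dist V x y"
  using norm_dist_triangle[of x "vzero V" y] norm_dist_triangle[of y "vzero V" x] assms
    norm_dist_commute[of x y]
  by (simp add: norm_dist_zero zero_closed)

lemma tendsto_vnorm:
  assumes "\<And>k. s k \<in> vcarrier V" "l \<in> vcarrier V" "(\<lambda>k. norm_dist V (s k) l) \<longlonglongrightarrow> 0"
  shows "(\<lambda>k. vnorm V (s k)) \<longlonglongrightarrow> vnorm V l"
proof (rule LIM_zero_cancel, rule Lim_null_comparison[OF _ assms(3)])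
  show "\<forall>\<^sub>F k in sequentially. norm (vnorm V (s k) - vnorm V l) \<le> norm_dist V (s k) l"
    using assms by (simp add: abs_norm_diff_le)
qed

lemma vnorm_vsum_list_le:
  "set xs \<subseteq> vcarrier V \<Longrightarrow> vnorm V (vsum_list V xs) \<le> (\<Sum>x\<leftarrow>xs. vnorm V x)"
proof (induction xs)
  case Nil
  then show ?case by (simp add: vsum_list_def seminorm_zero)
next
  case (Cons x xs)
  then show ?case
    using seminorm_triangle[of x "vsum_list V xs"] vsum_list_closed[of xs]
    by (simp add: vsum_list_def)
qed

section \<open>Cauchy sequences in a seminormed space\<close>

lemma cauchy_seqs_carrier: "s \<in> cauchy_seqs V \<Longrightarrow> s k \<in> vcarrier V"
  by (auto simp: cauchy_seqs_def)

lemma cauchy_seqsE: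
  assumes "s \<in> cauchy_seqs V" "e > 0"
  obtains N where "\<And>j k. \<lbrakk>j \<ge> N; k \<ge> N\<rbrakk> \<Longrightarrow> norm_dist V (s j) (s k) < e"
proof -
  have "\<exists>N. \<forall>j\<ge>N. \<forall>k\<ge>N. norm_dist V (s j) (s k) < e"
    using assms by (simp add: cauchy_seqs_def)
  then show thesis
    using that by metis
qed

lemma cauchy_seqs_const: "x \<in> vcarrier V \<Longrightarrow> (\<lambda>_. x) \<in> cauchy_seqs V"
  by (auto simp: cauchy_seqs_def norm_dist_self)

lemma cauchy_seqs_add:
  assumes s: "s \<in> cauchy_seqs V" and t: "t \<in> cauchy_seqs V"
  shows "(\<lambda>k. vadd V (s k) (t k)) \<in> cauchy_seqs V"
proof -
  note c = cauchy_seqs_carrier[OF s] cauchy_seqs_carrier[OF t]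
  have "\<exists>N. \<forall>j\<ge>N. \<forall>k\<ge>N. norm_dist V (vadd V (s j) (t j)) (vadd V (s k) (t k)) < e"
    if e: "e > 0" for e
  proof -
    have "e / 2 > 0" using e by simp
    then obtain M where M: "\<And>j k. \<lbrakk>j \<ge> M; k \<ge> M\<rbrakk> \<Longrightarrow> norm_dist V (s j) (s k) < e / 2"
      using cauchy_seqsE[OF s] by metis
    obtain N where N: "\<And>j k. \<lbrakk>j \<ge> N; k \<ge> N\<rbrakk> \<Longrightarrow> norm_dist V (t j) (t k) < e / 2"
      using cauchy_seqsE[OF t \<open>e / 2 > 0\<close>] by metis
    have "norm_dist V (vadd V (s j) (t j)) (vadd V (s k) (t k)) < e"
      if "j \<ge> max M N" "k \<ge> max M N" for j k
      using norm_dist_add[OF c(1)[of j] c(2)[of j] c(1)[of k] c(2)[of k]] M[of j k] N[of j k] that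
      by simp
    then show ?thesis by blast
  qed
  then show ?thesis
    using c by (auto simp: cauchy_seqs_def add_closed)
qed

lemma cauchy_seqs_scale:
  assumes s: "s \<in> cauchy_seqs V"
  shows "(\<lambda>k. vscale V c (s k)) \<in> cauchy_seqs V"
proof -
  note cs = cauchy_seqs_carrier[OF s]
  have "\<exists>N. \<forall>j\<ge>N. \<forall>k\<ge>N. norm_dist V (vscale V c (s j)) (vscale V c (s k)) < e"
    if e: "e > 0" for e
  proof -
    \<comment> \<open>Dividing the tolerance by \<open>norm c + 1\<close> instead of
      \<open>norm c\<close> covers \<open>c = 0\<close> as well.\<close>
    have pos: "norm c + 1 > 0"
      by (simp add: add_nonneg_pos)
    then have "e / (norm c + 1) > 0"
      using e by simp
    then obtain N where N: "\<And>j k. \<lbrakk>j \<ge> N; k \<ge> N\<rbrakk> \<Longrightarrow> norm_dist V (s j) (s k) < e / (norm c + 1)"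
      using cauchy_seqsE[OF s] by metis
    have "norm_dist V (vscale V c (s j)) (vscale V c (s k)) < e" if "j \<ge> N" "k \<ge> N" for j k
    proof -
      have "norm c * norm_dist V (s j) (s k) \<le> (norm c + 1) * norm_dist V (s j) (s k)"
        using norm_dist_nonneg[of "s j" "s k"] cs by (intro mult_right_mono) auto
      also have "\<dots> < e"
        using N[OF that] pos by (simp add: pos_less_divide_eq mult.commute)
      finally show ?thesis
        by (simp add: norm_dist_scale cs)
    qed
    then show ?thesis by blast
  qed
  then show ?thesis
    using cs by (auto simp: cauchy_seqs_def scale_closed)
qed

text \<open>By the reverse triangle inequality the norms form a real Cauchy sequence. Their limit is
  the candidate for the norm of a class in the completion.\<close>

lemma convergent_vnorm_cauchy:
  assumes s: "s \<in> cauchy_seqs V"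
  shows "convergent (\<lambda>k. vnorm V (s k))"
proof -
  have "\<exists>N. \<forall>j\<ge>N. \<forall>k\<ge>N. norm (vnorm V (s j) - vnorm V (s k)) < e" if e: "e > 0" for e
  proof -
    obtain N where N: "\<And>j k. \<lbrakk>j \<ge> N; k \<ge> N\<rbrakk> \<Longrightarrow> norm_dist V (s j) (s k) < e"
      using cauchy_seqsE[OF s e] by metis
    have "norm (vnorm V (s j) - vnorm V (s k)) < e" if "j \<ge> N" "k \<ge> N" for j k
      using abs_norm_diff_le[OF cauchy_seqs_carrier[OF s] cauchy_seqs_carrier[OF s], of j k]
        N[OF that] by simp
    then show ?thesis by blast
  qed
  then show ?thesis
    by (simp add: Cauchy_iff flip: Cauchy_convergent_iff)
qed

end

lemma (in carrier_normed_space) norm_dist_eq_zero: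
  "\<lbrakk>x \<in> vcarrier V; y \<in> vcarrier V; norm_dist V x y = 0\<rbrakk> \<Longrightarrow> x = y"
  by (simp add: norm_dist_def norm_eq_zero_iff diff_closed eq_of_diff_zero)

text \<open>Here definiteness enters. Applied to the target space, it makes the value of an
  extension to the completion unique even when the source is only seminormed.\<close>

lemma (in carrier_normed_space) limit_unique:
  assumes "\<And>k. s k \<in> vcarrier V" "x \<in> vcarrier V" "y \<in> vcarrier V"
    and "(\<lambda>k. norm_dist V (s k) x) \<longlonglongrightarrow> 0" "(\<lambda>k. norm_dist V (s k) y) \<longlonglongrightarrow> 0"
  shows "x = y"
proof -
  have "(\<lambda>k. norm_dist V (s k) x + norm_dist V (s k) y) \<longlonglongrightarrow> 0 + 0"
    by (intro tendsto_add assms)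
  then have "norm_dist V x y \<le> 0"
    using assms(1-3) norm_dist_triangle[of x y] norm_dist_commute[of x]
    by (intro LIMSEQ_le_const[where X = "\<lambda>k. norm_dist V (s k) x + norm_dist V (s k) y"]) auto
  then show ?thesis
    using assms norm_dist_nonneg[of x y] norm_dist_eq_zero[of x y] by simp
qed

text \<open>\<open>bounded_linear_map\<close> puts no sign on its constant. Since seminorms are
  nonnegative, \<open>max C 0\<close> serves too, and monotonicity arguments can rely on its
  sign.\<close>

lemma bounded_linear_mapE:
  assumes "bounded_linear_map V W f" "carrier_seminormed_space V"
  obtains C where "C \<ge> 0" "\<And>x. x \<in> vcarrier V \<Longrightarrow> vnorm W (f x) \<le> C * vnorm V x"
proof -
  interpret carrier_seminormed_space V by fact
  from assms(1) obtain C where C: "\<And>x. x \<in> vcarrier V \<Longrightarrow> vnorm W (f x) \<le> C * vnorm V x"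
    by (auto simp: bounded_linear_map_def)
  have "vnorm W (f x) \<le> max C 0 * vnorm V x" if "x \<in> vcarrier V" for x
    using C[OF that] mult_right_mono[of C "max C 0" "vnorm V x"] seminorm_nonneg[OF that] by simp
  then show thesis
    by (intro that[of "max C 0"]) auto
qed

lemma operator_norm_le:
  assumes "carrier_seminormed_space V" "M \<ge> 0"
    and "\<And>x. x \<in> vcarrier V \<Longrightarrow> vnorm W (f x) \<le> M * vnorm V x"
  shows "operator_norm V W f \<le> M"
proof -
  interpret carrier_seminormed_space V by fact
  have "{x \<in> vcarrier V. vnorm V x \<le> 1} \<noteq> {}"
    using zero_closed seminorm_zero by force
  moreover have "vnorm W (f x) \<le> M" if "x \<in> vcarrier V" "vnorm V x \<le> 1" for x
    using assms(3)[OF that(1)] mult_left_mono[OF that(2) assms(2)] by simp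
  ultimately show ?thesis
    unfolding operator_norm_def by (intro cSUP_least) auto
qed

section \<open>Extension to the completion\<close>

context carrier_seminormed_space
begin

lemma equiv_null_rel: "equiv (cauchy_seqs V) (null_rel V)"
proof (rule equivI)
  show "null_rel V \<subseteq> cauchy_seqs V \<times> cauchy_seqs V"
    by (auto simp: null_rel_def)
  show "refl_on (cauchy_seqs V) (null_rel V)"
    by (auto simp: refl_on_def null_rel_def norm_dist_self cauchy_seqs_carrier)
  show "sym (null_rel V)"
    by (auto simp: sym_def null_rel_def norm_dist_commute cauchy_seqs_carrier)
  show "trans (null_rel V)"
  proof (rule transI)
    fix s t u assume st: "(s, t) \<in> null_rel V" and tu: "(t, u) \<in> null_rel V"
    then have c: "s \<in> cauchy_seqs V" "t \<in> cauchy_seqs V" "u \<in> cauchy_seqs V"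
      by (auto simp: null_rel_def)
    have "(\<lambda>k. norm_dist V (s k) (t k) + norm_dist V (t k) (u k)) \<longlonglongrightarrow> 0"
      using st tu by (intro tendsto_add_zero) (auto simp: null_rel_def)
    then have "(\<lambda>k. norm_dist V (s k) (u k)) \<longlonglongrightarrow> 0"
      by (rule Lim_null_comparison[rotated])
        (use c in \<open>auto simp: norm_dist_nonneg norm_dist_triangle cauchy_seqs_carrier\<close>)
    with c show "(s, u) \<in> null_rel V"
      by (simp add: null_rel_def)
  qed
qed

lemma completion_carrierI: "s \<in> cauchy_seqs V \<Longrightarrow> null_rel V `` {s} \<in> vcarrier (norm_completion V)"
  by (simp add: norm_completion_def quotientI)

lemma completion_carrierE:
  assumes "A \<in> vcarrier (norm_completion V)"
  obtains s where "s \<in> cauchy_seqs V" "A = null_rel V `` {s}"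
  using assms by (auto simp: norm_completion_def elim!: quotientE)

lemma null_rel_class_eq: "(s, t) \<in> null_rel V \<Longrightarrow> null_rel V `` {s} = null_rel V `` {t}"
  using equiv_null_rel by (rule equiv_class_eq)

lemma self_in_null_rel_class: "s \<in> cauchy_seqs V \<Longrightarrow> s \<in> null_rel V `` {s}"
  using equiv_null_rel by (rule equiv_class_self)

text \<open>Adding null sequences gives a null sequence, so the union over all representatives in
  \<open>norm_completion\<close> collapses to a single class.\<close>

lemma completion_add:
  assumes "s \<in> cauchy_seqs V" "t \<in> cauchy_seqs V"
  shows "vadd (norm_completion V) (null_rel V `` {s}) (null_rel V `` {t}) =
    null_rel V `` {\<lambda>k. vadd V (s k) (t k)}"
proof -
  have "congruent2 (null_rel V) (null_rel V) (\<lambda>s t. null_rel V `` {\<lambda>k. vadd V (s k) (t k)})"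
  proof (rule congruent2I')
    fix s s' t t' assume st: "(s, s') \<in> null_rel V" "(t, t') \<in> null_rel V"
    then have c: "s \<in> cauchy_seqs V" "s' \<in> cauchy_seqs V" "t \<in> cauchy_seqs V" "t' \<in> cauchy_seqs V"
      by (auto simp: null_rel_def)
    note cc = c[THEN cauchy_seqs_carrier]
    have "(\<lambda>k. norm_dist V (s k) (s' k) + norm_dist V (t k) (t' k)) \<longlonglongrightarrow> 0"
      using st by (intro tendsto_add_zero) (auto simp: null_rel_def)
    then have "(\<lambda>k. norm_dist V (vadd V (s k) (t k)) (vadd V (s' k) (t' k))) \<longlonglongrightarrow> 0"
      by (rule Lim_null_comparison[rotated])
        (use cc in \<open>auto simp: norm_dist_nonneg norm_dist_add add_closed\<close>)
    then show "null_rel V `` {\<lambda>k. vadd V (s k) (t k)} = null_rel V `` {\<lambda>k. vadd V (s' k) (t' k)}"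
      using c by (intro null_rel_class_eq) (simp add: null_rel_def cauchy_seqs_add)
  qed
  from UN_equiv_class2[OF equiv_null_rel equiv_null_rel this assms]
  show ?thesis by (simp add: norm_completion_def)
qed

lemma completion_scale:
  assumes "s \<in> cauchy_seqs V"
  shows "vscale (norm_completion V) c (null_rel V `` {s}) = null_rel V `` {\<lambda>k. vscale V c (s k)}"
proof -
  have "congruent (null_rel V) (\<lambda>s. null_rel V `` {\<lambda>k. vscale V c (s k)})"
  proof (rule congruentI)
    fix s s' assume st: "(s, s') \<in> null_rel V"
    then have c: "s \<in> cauchy_seqs V" "s' \<in> cauchy_seqs V"
      by (auto simp: null_rel_def)
    have "(\<lambda>k. norm c * norm_dist V (s k) (s' k)) \<longlonglongrightarrow> 0"
      using st by (intro tendsto_mult_right_zero) (auto simp: null_rel_def)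
    then show "null_rel V `` {\<lambda>k. vscale V c (s k)} = null_rel V `` {\<lambda>k. vscale V c (s' k)}"
      using c by (intro null_rel_class_eq)
        (simp add: null_rel_def cauchy_seqs_scale norm_dist_scale cauchy_seqs_carrier)
  qed
  from UN_equiv_class[OF equiv_null_rel this assms]
  show ?thesis by (simp add: norm_completion_def)
qed

text \<open>The norm of a class is described as a limit common to all its members. The limit exists
  along one member by \<open>convergent_vnorm_cauchy\<close>, and equivalent sequences share it by
  the reverse triangle inequality.\<close>

lemma completion_norm:
  assumes s: "s \<in> cauchy_seqs V"
  shows "(\<lambda>k. vnorm V (s k)) \<longlonglongrightarrow> vnorm (norm_completion V) (null_rel V `` {s})"
proof -
  obtain L where L: "(\<lambda>k. vnorm V (s k)) \<longlonglongrightarrow> L"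
    using convergent_vnorm_cauchy[OF s] by (auto simp: convergent_def)
  have *: "(\<lambda>k. vnorm V (t k)) \<longlonglongrightarrow> L" if "t \<in> null_rel V `` {s}" for t
  proof -
    have st: "s \<in> cauchy_seqs V" "t \<in> cauchy_seqs V" "(\<lambda>k. norm_dist V (s k) (t k)) \<longlonglongrightarrow> 0"
      using that by (auto simp: null_rel_def)
    have "(\<lambda>k. vnorm V (s k) - vnorm V (t k)) \<longlonglongrightarrow> 0"
      by (rule Lim_null_comparison[OF _ st(3)])
        (use st in \<open>auto simp: abs_norm_diff_le cauchy_seqs_carrier\<close>)
    from tendsto_diff[OF L this] show ?thesis by simp
  qed
  have "vnorm (norm_completion V) (null_rel V `` {s}) = L"
    unfolding norm_completion_def nspace.simps
    by (rule the_equality) (use * self_in_null_rel_class[OF s] LIMSEQ_unique L in blast)+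
  with L show ?thesis by simp
qed

lemma completion_norm_embed:
  "z \<in> vcarrier V \<Longrightarrow> vnorm (norm_completion V) (completion_embed V z) = vnorm V z"
  using completion_norm[OF cauchy_seqs_const, of z] LIMSEQ_unique tendsto_const
  by (metis completion_embed_def)

lemma completion_embed_closed:
  "z \<in> vcarrier V \<Longrightarrow> completion_embed V z \<in> vcarrier (norm_completion V)"
  by (simp add: completion_embed_def completion_carrierI cauchy_seqs_const)

text \<open>Density of \<open>V\<close> in its completion: the distance from the class of
  \<open>s\<close> to the embedded \<open>s k\<close> is the limit over \<open>j\<close> of
  \<open>norm_dist V (s j) (s k)\<close>, which the Cauchy condition makes small for large
  \<open>k\<close>.\<close>

lemma completion_dist_embed:
  assumes s: "s \<in> cauchy_seqs V"
  shows "(\<lambda>k. norm_dist (norm_completion V) (null_rel V `` {s}) (completion_embed V (s k))) \<longlonglongrightarrow> 0"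
proof (rule LIMSEQ_I)
  note c = cauchy_seqs_carrier[OF s]
  fix e :: real assume "e > 0"
  then have "e / 2 > 0" by simp
  then obtain N where N: "\<And>j k. \<lbrakk>j \<ge> N; k \<ge> N\<rbrakk> \<Longrightarrow> norm_dist V (s j) (s k) < e / 2"
    using cauchy_seqsE[OF s] by metis
  have "\<bar>norm_dist (norm_completion V) (null_rel V `` {s}) (completion_embed V (s k))\<bar> < e"
    if k: "k \<ge> N" for k
  proof -
    have sk: "(\<lambda>_. s k) \<in> cauchy_seqs V" "(\<lambda>_. vscale V (- 1) (s k)) \<in> cauchy_seqs V"
      using c by (auto intro: cauchy_seqs_const scale_closed)
    have lim: "(\<lambda>j. norm_dist V (s j) (s k)) \<longlonglongrightarrow>
        norm_dist (norm_completion V) (null_rel V `` {s}) (completion_embed V (s k))"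
      using completion_norm[OF cauchy_seqs_add[OF s sk(2)]]
      by (simp add: norm_dist_def vdiff_def completion_embed_def completion_scale[OF sk(1)]
          completion_add[OF s sk(2)])
    have "norm_dist (norm_completion V) (null_rel V `` {s}) (completion_embed V (s k)) \<le> e / 2"
      by (rule LIMSEQ_le_const2[OF lim]) (use N k in \<open>auto intro!: exI[of _ N] less_imp_le\<close>)
    moreover have "0 \<le> norm_dist (norm_completion V) (null_rel V `` {s}) (completion_embed V (s k))"
      by (rule LIMSEQ_le_const[OF lim]) (use c in \<open>auto intro!: norm_dist_nonneg\<close>)
    ultimately show ?thesis using \<open>e > 0\<close> by simp
  qed
  then show "\<exists>N. \<forall>k\<ge>N. norm (norm_dist (norm_completion V) (null_rel V `` {s})
      (completion_embed V (s k)) - 0) < e"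
    by auto
qed

section \<open>The operator norm on a seminormed space\<close>

lemma operator_norm_upper:
  assumes f: "bounded_linear_map V W f" and x: "x \<in> vcarrier V" "vnorm V x \<le> 1"
  shows "vnorm W (f x) \<le> operator_norm V W f"
  unfolding operator_norm_def
proof (rule cSUP_upper)
  obtain C where C: "C \<ge> 0" "\<And>x. x \<in> vcarrier V \<Longrightarrow> vnorm W (f x) \<le> C * vnorm V x"
    using bounded_linear_mapE[OF f carrier_seminormed_space_axioms] by blast
  show "bdd_above ((\<lambda>x. vnorm W (f x)) ` {x \<in> vcarrier V. vnorm V x \<le> 1})"
  proof (rule bdd_aboveI2[where M = C])
    fix x assume "x \<in> {x \<in> vcarrier V. vnorm V x \<le> 1}"
    then show "vnorm W (f x) \<le> C"
      using C(2)[of x] mult_left_mono[of "vnorm V x" 1 C] C(1) by auto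
  qed
qed (use x in simp)

lemma norm_le_operator_norm:
  assumes f: "bounded_linear_map V W f" and W: "carrier_seminormed_space W" and x: "x \<in> vcarrier V"
  shows "vnorm W (f x) \<le> operator_norm V W f * vnorm V x"
proof -
  interpret W: carrier_seminormed_space W by fact
  have lin: "linear_map V W f"
    using f by (simp add: bounded_linear_map_def)
  obtain C where C: "C \<ge> 0" "\<And>x. x \<in> vcarrier V \<Longrightarrow> vnorm W (f x) \<le> C * vnorm V x"
    using bounded_linear_mapE[OF f carrier_seminormed_space_axioms] by blast
  show ?thesis
  proof (cases "vnorm V x = 0")
    \<comment> \<open>A nonzero vector may have seminorm zero and then cannot be normalised;
      boundedness forces its image to have norm zero.\<close>
    case True
    with C(2)[OF x] show ?thesis by simp
  next
    case False
    then have pos: "vnorm V x > 0"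
      using seminorm_nonneg[OF x] by simp
    define r where "r = (of_real (inverse (vnorm V x)) :: 'k)"
    have r: "norm r = inverse (vnorm V x)"
      unfolding r_def norm_of_real using pos by simp
    have "vnorm W (f (vscale V r x)) \<le> operator_norm V W f"
      using x pos r by (intro operator_norm_upper f) (auto simp: scale_closed seminorm_scale)
    then show ?thesis
      using pos r x lin
      by (simp add: linear_map_scale W.seminorm_scale linear_map_closed field_simps)
  qed
qed

lemma operator_norm_nonneg:
  assumes f: "bounded_linear_map V W f" and W: "carrier_seminormed_space W"
  shows "0 \<le> operator_norm V W f"
proof -
  interpret W: carrier_seminormed_space W by fact
  have lin: "linear_map V W f"
    using f by (simp add: bounded_linear_map_def)
  have "vnorm W (f (vzero V)) \<le> operator_norm V W f"
    by (intro operator_norm_upper f) (simp_all add: zero_closed seminorm_zero)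
  then show ?thesis
    using W.seminorm_nonneg[OF linear_map_closed[OF lin zero_closed]] by linarith
qed

text \<open>The class of \<open>s\<close> is the limit of the embedded terms \<open>s k\<close>, and
  a bounded linear map is continuous. Norm estimates for \<open>f\<close> can therefore be carried
  over to any bounded extension.\<close>

lemma extension_tendsto:
  assumes F: "bounded_linear_map (norm_completion V) Y F" and ext: "extends_to_completion V f F"
    and Y: "carrier_seminormed_space Y"
    and s: "s \<in> cauchy_seqs V"
  shows "(\<lambda>k. vnorm Y (f (s k))) \<longlonglongrightarrow> vnorm Y (F (null_rel V `` {s}))"
proof -
  interpret Y: carrier_seminormed_space Y by fact
  let ?N = "norm_completion V" and ?s = "null_rel V `` {s}"
  have lin: "linear_map ?N Y F"
    using F by (simp add: bounded_linear_map_def)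
  from F obtain C where C: "\<And>x. x \<in> vcarrier ?N \<Longrightarrow> vnorm Y (F x) \<le> C * vnorm ?N x"
    by (auto simp: bounded_linear_map_def)
  have sk: "s k \<in> vcarrier V" for k
    using s by (rule cauchy_seqs_carrier)
  have em: "completion_embed V (s k) \<in> vcarrier ?N" for k
    using sk by (rule completion_embed_closed)
  have mem: "?s \<in> vcarrier ?N"
    using s by (rule completion_carrierI)
  have neg: "vscale ?N (- 1) (completion_embed V (s k)) = completion_embed V (vscale V (- 1) (s k))" for k
    by (simp add: completion_embed_def completion_scale cauchy_seqs_const sk)
  have diff: "F (vdiff ?N ?s (completion_embed V (s k))) = vdiff Y (F ?s) (f (s k))" for k
    using linear_map_diff[OF lin mem em[of k]] ext sk[of k]
    by (simp add: neg completion_embed_closed scale_closed extends_to_completion_def)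
  \<comment> \<open>Membership is verified through the representing sequence of the difference,
    using closure of Cauchy sequences under addition.\<close>
  have dmem: "vdiff ?N ?s (completion_embed V (s k)) \<in> vcarrier ?N" for k
    using s sk[of k] unfolding vdiff_def neg
    by (simp add: completion_embed_def completion_add cauchy_seqs_const scale_closed
        completion_carrierI cauchy_seqs_add)
  have fs: "f (s k) \<in> vcarrier Y" for k
    using linear_map_closed[OF lin em[of k]] ext sk[of k] by (simp add: extends_to_completion_def)
  have Fs: "F ?s \<in> vcarrier Y"
    using linear_map_closed[OF lin mem] .
  have le: "norm_dist Y (f (s k)) (F ?s) \<le> C * norm_dist ?N ?s (completion_embed V (s k))" for k
    using C[OF dmem[of k]] Y.norm_dist_commute[OF fs[of k] Fs] by (simp add: norm_dist_def diff)
  have "(\<lambda>k. C * norm_dist ?N ?s (completion_embed V (s k))) \<longlonglongrightarrow> 0"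
    using completion_dist_embed[OF s] by (rule tendsto_mult_right_zero)
  then have "(\<lambda>k. norm_dist Y (f (s k)) (F ?s)) \<longlonglongrightarrow> 0"
    by (rule Lim_null_comparison[rotated]) (use le in \<open>auto simp: Y.norm_dist_nonneg fs Fs\<close>)
  then show ?thesis
    by (rule Y.tendsto_vnorm[OF fs Fs])
qed

text \<open>Both sides are limits along a representing sequence, so the inequality survives with the
  same constant.\<close>

lemma extension_bound:
  assumes F: "bounded_linear_map (norm_completion V) Y F" and ext: "extends_to_completion V f F"
    and Y: "carrier_seminormed_space Y"
    and M: "\<And>x. x \<in> vcarrier V \<Longrightarrow> vnorm Y (f x) \<le> M * vnorm V x"
    and A: "A \<in> vcarrier (norm_completion V)"
  shows "vnorm Y (F A) \<le> M * vnorm (norm_completion V) A"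
proof -
  obtain s where s: "s \<in> cauchy_seqs V" "A = null_rel V `` {s}"
    using A by (rule completion_carrierE)
  show ?thesis
    unfolding s(2)
    by (rule LIMSEQ_le[OF extension_tendsto[OF F ext Y s(1)] tendsto_mult_left[OF completion_norm[OF s(1)]]])
      (use M cauchy_seqs_carrier[OF s(1)] in blast)
qed

text \<open>One inequality is \<open>extension_bound\<close>. For the other, the embedding preserves
  the seminorm, so the unit ball of \<open>V\<close> is carried into that of the completion.\<close>

lemma operator_norm_extension:
  assumes F: "bounded_linear_map (norm_completion V) Y F" and ext: "extends_to_completion V f F"
    and f: "bounded_linear_map V Y f" and Y: "carrier_seminormed_space Y"
  shows "operator_norm (norm_completion V) Y F = operator_norm V Y f"
proof (rule antisym)
  let ?N = "norm_completion V" and ?M = "operator_norm V Y f"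
  let ?B = "{A \<in> vcarrier ?N. vnorm ?N A \<le> 1}"
  note bound = extension_bound[OF F ext Y norm_le_operator_norm[OF f Y]]
  have *: "vnorm Y (F A) \<le> ?M" if "A \<in> ?B" for A
    using bound[of A] that mult_left_mono[OF _ operator_norm_nonneg[OF f Y], of "vnorm ?N A" 1]
    by simp
  have "completion_embed V (vzero V) \<in> ?B"
    by (simp add: completion_embed_closed completion_norm_embed zero_closed seminorm_zero)
  then show "operator_norm ?N Y F \<le> ?M"
    unfolding operator_norm_def[of ?N] using * by (intro cSUP_least) auto
  have "vnorm Y (f z) \<le> operator_norm ?N Y F" if "z \<in> vcarrier V" "vnorm V z \<le> 1" for z
  proof -
    have "vnorm Y (F (completion_embed V z)) \<le> operator_norm ?N Y F"
      unfolding operator_norm_def[of ?N]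
    proof (rule cSUP_upper)
      show "bdd_above ((\<lambda>A. vnorm Y (F A)) ` ?B)"
        using * by (rule bdd_aboveI2)
    qed (simp add: that completion_embed_closed completion_norm_embed)
    then show ?thesis
      using ext that by (simp add: extends_to_completion_def)
  qed
  moreover have "{x \<in> vcarrier V. vnorm V x \<le> 1} \<noteq> {}"
    using zero_closed seminorm_zero by force
  ultimately show "?M \<le> operator_norm ?N Y F"
    unfolding operator_norm_def[of V] by (intro cSUP_least) auto
qed

text \<open>The bound on \<open>F\<close> pulls back along the norm-preserving embedding. Linearity
  of \<open>f\<close> is assumed separately, since \<open>extends_to_completion\<close> does not
  control \<open>f\<close> off the carrier.\<close>

lemma bounded_linear_map_if_extension:
  assumes F: "bounded_linear_map (norm_completion V) Y F" and ext: "extends_to_completion V f F"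
    and f: "linear_map V Y f"
  shows "bounded_linear_map V Y f"
  using assms completion_embed_closed completion_norm_embed
  by (fastforce simp: bounded_linear_map_def extends_to_completion_def)

text \<open>The class of \<open>s\<close> is sent to the limit of \<open>f (s k)\<close>:
  boundedness makes the image sequence Cauchy, completeness of \<open>Y\<close> supplies the limit,
  and linearity and the bound pass to limits.\<close>

lemma extension_exists:
  assumes f: "bounded_linear_map V Y f" and Y: "carrier_banach_space Y"
  shows "\<exists>F. bounded_linear_map (norm_completion V) Y F \<and> extends_to_completion V f F"
proof -
  interpret Y: carrier_banach_space Y by fact
  have lin: "linear_map V Y f"
    using f by (simp add: bounded_linear_map_def)
  obtain C where C: "C \<ge> 0" "\<And>x. x \<in> vcarrier V \<Longrightarrow> vnorm Y (f x) \<le> C * vnorm V x"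
    using bounded_linear_mapE[OF f carrier_seminormed_space_axioms] by blast
  have dist: "norm_dist Y (f x) (f y) \<le> C * norm_dist V x y"
    if "x \<in> vcarrier V" "y \<in> vcarrier V" for x y
    using C(2)[of "vdiff V x y"] linear_map_diff[OF lin that] that
    by (simp add: norm_dist_def diff_closed scale_closed)
  have fs: "f (s k) \<in> vcarrier Y" if "s \<in> cauchy_seqs V" for s k
    using that by (intro linear_map_closed[OF lin] cauchy_seqs_carrier)
  have cauchy: "(\<lambda>k. f (s k)) \<in> cauchy_seqs Y" if s: "s \<in> cauchy_seqs V" for s
  proof -
    have "\<exists>N. \<forall>j\<ge>N. \<forall>k\<ge>N. norm_dist Y (f (s j)) (f (s k)) < e" if e: "e > 0" for e
    proof -
      have "e / (C + 1) > 0"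
        using e C(1) by simp
      then obtain N where N: "\<And>j k. \<lbrakk>j \<ge> N; k \<ge> N\<rbrakk> \<Longrightarrow> norm_dist V (s j) (s k) < e / (C + 1)"
        using cauchy_seqsE[OF s] by metis
      have "norm_dist Y (f (s j)) (f (s k)) < e" if "j \<ge> N" "k \<ge> N" for j k
      proof -
        have "C * norm_dist V (s j) (s k) \<le> (C + 1) * norm_dist V (s j) (s k)"
          using norm_dist_nonneg[of "s j" "s k"] cauchy_seqs_carrier[OF s]
          by (intro mult_right_mono) auto
        also have "\<dots> < e"
          using N[OF that] C(1) by (simp add: pos_less_divide_eq mult.commute)
        finally show ?thesis
          using dist[of "s j" "s k"] cauchy_seqs_carrier[OF s] by (simp add: order_le_less_trans)
      qed
      then show ?thesis by blast
    qed
    then show ?thesis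
      using fs[OF s] by (auto simp: cauchy_seqs_def)
  qed
  \<comment> \<open>Asking for one limit along every member of the class keeps the description in
    \<open>F\<close> free of a choice of representative.\<close>
  define lim where "lim A y \<longleftrightarrow> y \<in> vcarrier Y \<and> (\<forall>s\<in>A. (\<lambda>k. norm_dist Y (f (s k)) y) \<longlonglongrightarrow> 0)"
    for A y
  define F where "F = (\<lambda>A\<in>vcarrier (norm_completion V). THE y. lim A y)"
  have F_eq: "F (null_rel V `` {s}) = y"
    if s: "s \<in> cauchy_seqs V" and y: "y \<in> vcarrier Y" "(\<lambda>k. norm_dist Y (f (s k)) y) \<longlonglongrightarrow> 0" for s y
  proof -
    have "(\<lambda>k. norm_dist Y (f (t k)) y) \<longlonglongrightarrow> 0" if "t \<in> null_rel V `` {s}" for t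
    proof -
      have t: "t \<in> cauchy_seqs V" "(\<lambda>k. norm_dist V (s k) (t k)) \<longlonglongrightarrow> 0"
        using that by (auto simp: null_rel_def)
      \<comment> \<open>Replacing \<open>s\<close> by the equivalent \<open>t\<close> costs at most
        \<open>C * norm_dist V (s k) (t k)\<close>, which tends to zero.\<close>
      have le: "norm_dist Y (f (t k)) y \<le> C * norm_dist V (s k) (t k) + norm_dist Y (f (s k)) y" for k
        using Y.norm_dist_triangle[OF fs[OF t(1), of k] y(1) fs[OF s, of k]]
          dist[of "t k" "s k"] norm_dist_commute[of "s k" "t k"]
          cauchy_seqs_carrier[OF s] cauchy_seqs_carrier[OF t(1)]
        by simp
      have "(\<lambda>k. C * norm_dist V (s k) (t k) + norm_dist Y (f (s k)) y) \<longlonglongrightarrow> 0"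
        by (intro tendsto_add_zero tendsto_mult_right_zero t y)
      then show ?thesis
        by (rule Lim_null_comparison[rotated])
          (use le fs[OF t(1)] y(1) in \<open>auto simp: Y.norm_dist_nonneg\<close>)
    qed
    then have "lim (null_rel V `` {s}) y"
      using y by (simp add: lim_def)
    moreover have "y' = y" if "lim (null_rel V `` {s}) y'" for y'
      using that y self_in_null_rel_class[OF s]
      by (intro Y.limit_unique[of "\<lambda>k. f (s k)"]) (auto simp: lim_def fs[OF s])
    ultimately have "(THE y. lim (null_rel V `` {s}) y) = y"
      by (rule the_equality)
    then show ?thesis
      by (simp add: F_def completion_carrierI[OF s])
  qed
  have F_lim: "F (null_rel V `` {s}) \<in> vcarrier Y"
    "(\<lambda>k. norm_dist Y (f (s k)) (F (null_rel V `` {s}))) \<longlonglongrightarrow> 0"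
    if s: "s \<in> cauchy_seqs V" for s
    using Y.complete[OF cauchy[OF s]] F_eq[OF s] by auto
  have "linear_map (norm_completion V) Y F"
    unfolding linear_map_def
  proof (intro conjI ballI allI)
    show "F \<in> vcarrier (norm_completion V) \<rightarrow>\<^sub>E vcarrier Y"
    proof (rule PiE_I)
      fix A assume "A \<in> vcarrier (norm_completion V)"
      then show "F A \<in> vcarrier Y"
        using F_lim(1) by (auto elim: completion_carrierE)
    qed (simp add: F_def)
  next
    fix A B assume "A \<in> vcarrier (norm_completion V)" "B \<in> vcarrier (norm_completion V)"
    then obtain s t where s: "s \<in> cauchy_seqs V" "A = null_rel V `` {s}"
      and t: "t \<in> cauchy_seqs V" "B = null_rel V `` {t}"
      by (metis completion_carrierE)
    have sum: "(\<lambda>k. norm_dist Y (f (s k)) (F A) + norm_dist Y (f (t k)) (F B)) \<longlonglongrightarrow> 0"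
      unfolding s(2) t(2) by (intro tendsto_add_zero F_lim s t)
    \<comment> \<open>Once the sum of the two limits is known to be a limit along the sum sequence,
      \<open>F_eq\<close> identifies it as the value of \<open>F\<close>.\<close>
    have "(\<lambda>k. norm_dist Y (f (vadd V (s k) (t k))) (vadd Y (F A) (F B))) \<longlonglongrightarrow> 0"
      by (rule Lim_null_comparison[OF _ sum])
        (use s t in \<open>auto simp: linear_map_add[OF lin] cauchy_seqs_carrier Y.norm_dist_add
          Y.norm_dist_nonneg fs F_lim(1) Y.add_closed\<close>)
    then show "F (vadd (norm_completion V) A B) = vadd Y (F A) (F B)"
      unfolding s(2) t(2) completion_add[OF s(1) t(1)]
      by (intro F_eq cauchy_seqs_add s t Y.add_closed F_lim(1))
  next
    fix c :: 'k and A assume "A \<in> vcarrier (norm_completion V)"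
    then obtain s where s: "s \<in> cauchy_seqs V" "A = null_rel V `` {s}"
      by (rule completion_carrierE)
    have "(\<lambda>k. norm c * norm_dist Y (f (s k)) (F A)) \<longlonglongrightarrow> 0"
      unfolding s(2) by (intro tendsto_mult_right_zero F_lim s)
    then have "(\<lambda>k. norm_dist Y (f (vscale V c (s k))) (vscale Y c (F A))) \<longlonglongrightarrow> 0"
      using s by (simp add: linear_map_scale[OF lin] cauchy_seqs_carrier Y.norm_dist_scale fs F_lim(1))
    then show "F (vscale (norm_completion V) c A) = vscale Y c (F A)"
      unfolding s(2) completion_scale[OF s(1)]
      by (intro F_eq cauchy_seqs_scale s Y.scale_closed F_lim(1))
  qed
  moreover have "vnorm Y (F A) \<le> C * vnorm (norm_completion V) A"
    if "A \<in> vcarrier (norm_completion V)" for A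
  proof -
    obtain s where s: "s \<in> cauchy_seqs V" "A = null_rel V `` {s}"
      using \<open>A \<in> _\<close> by (rule completion_carrierE)
    show ?thesis
      unfolding s(2)
      by (rule LIMSEQ_le[OF Y.tendsto_vnorm[OF fs[OF s(1)] F_lim[OF s(1)]]
            tendsto_mult_left[OF completion_norm[OF s(1)]]])
        (use C(2) cauchy_seqs_carrier[OF s(1)] in blast)
  qed
  moreover have "F (completion_embed V z) = f z" if "z \<in> vcarrier V" for z
    unfolding completion_embed_def
    by (rule F_eq)
      (use that in \<open>auto simp: cauchy_seqs_const linear_map_closed[OF lin] Y.norm_dist_self\<close>)
  ultimately show ?thesis
    by (auto simp: bounded_linear_map_def extends_to_completion_def)
qed

end

section \<open>The universal property of the algebraic tensor product\<close>

lemma lookup_free_scale: "Poly_Mapping.lookup (free_scale c f) x = c * Poly_Mapping.lookup f x"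
  by (simp add: free_scale_def map.rep_eq when_def)

lemma vector_space_free_scale: "vector_space (free_scale :: 'k::field \<Rightarrow> ('b \<Rightarrow>\<^sub>0 'k) \<Rightarrow> _)"
  by unfold_locales (auto intro!: poly_mapping_eqI simp: lookup_free_scale lookup_add algebra_simps)

text \<open>Opens the library theory of spans and subspaces for the
  \<open>module.span free_scale\<close> that occurs in \<open>tensor_rel\<close>.\<close>

interpretation free: vector_space "free_scale :: 'k::field \<Rightarrow> ('b \<Rightarrow>\<^sub>0 'k) \<Rightarrow> _"
  by (rule vector_space_free_scale)

lemma free_scale_single: "free_scale c (Poly_Mapping.single x d) = Poly_Mapping.single x (c * d)"
  by (rule poly_mapping_eqI) (simp add: lookup_free_scale lookup_single when_def)

lemma poly_mapping_sum_singles: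
  "(\<Sum>x\<in>Poly_Mapping.keys f. Poly_Mapping.single x (Poly_Mapping.lookup f x)) = f"
  by (rule poly_mapping_eqI)
    (simp add: lookup_sum lookup_single when_def in_keys_iff)

lemma subspace_free_space: "free.subspace (free_space n X)"
proof (rule free.subspaceI)
  show "f + g \<in> free_space n X" if "f \<in> free_space n X" "g \<in> free_space n X" for f g
    using that Poly_Mapping.keys_add[of f g] by (auto simp: free_space_def)
  show "free_scale c f \<in> free_space n X" if "f \<in> free_space n X" for c f
    using that by (auto simp: free_space_def in_keys_iff lookup_free_scale)
qed (simp add: free_space_def)

lemmas free_space_zero = free.subspace_0[OF subspace_free_space]
lemmas free_space_add = free.subspace_add[OF subspace_free_space]
lemmas free_space_scale = free.subspace_scale[OF subspace_free_space]
lemmas free_space_neg = free.subspace_neg[OF subspace_free_space]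
lemmas free_space_diff = free.subspace_diff[OF subspace_free_space]

lemma free_space_single: "x \<in> tuples n X \<Longrightarrow> Poly_Mapping.single x c \<in> free_space n X"
  by (auto simp: free_space_def)

lemma tuples_upd:
  "\<lbrakk>x \<in> tuples n X; i \<in> {1..n}; u \<in> vcarrier (X i)\<rbrakk> \<Longrightarrow> x(i := u) \<in> tuples n X"
  by (auto simp: tuples_def PiE_iff extensional_def)

lemma tuples_carrier: "\<lbrakk>x \<in> tuples n X; i \<in> {1..n}\<rbrakk> \<Longrightarrow> x i \<in> vcarrier (X i)"
  by (auto simp: tuples_def)

lemma equiv_tensor_rel: "equiv (free_space n X) (tensor_rel n X)"
proof (rule equivI)
  show "tensor_rel n X \<subseteq> free_space n X \<times> free_space n X"
    by (auto simp: tensor_rel_def)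
  show "refl_on (free_space n X) (tensor_rel n X)"
    by (auto simp: refl_on_def tensor_rel_def free.span_zero)
  show "sym (tensor_rel n X)"
    unfolding sym_def tensor_rel_def using free.span_neg by fastforce
  show "trans (tensor_rel n X)"
  proof (rule transI)
    fix f g h assume "(f, g) \<in> tensor_rel n X" "(g, h) \<in> tensor_rel n X"
    then show "(f, h) \<in> tensor_rel n X"
      using free.span_add[of "f - g" "multilinear_relations n X" "g - h"]
      by (auto simp: tensor_rel_def)
  qed
qed

lemma tensor_rel_class_eq:
  "\<lbrakk>f \<in> free_space n X; g \<in> free_space n X; f - g \<in> free.span (multilinear_relations n X)\<rbrakk>
    \<Longrightarrow> tensor_rel n X `` {f} = tensor_rel n X `` {g}"
  by (rule equiv_class_eq[OF equiv_tensor_rel]) (simp add: tensor_rel_def)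

lemma alg_tensor_carrierI:
  "f \<in> free_space n X \<Longrightarrow> tensor_rel n X `` {f} \<in> vcarrier (alg_tensor n X)"
  by (simp add: alg_tensor_def quotientI)

lemma alg_tensor_carrierE:
  assumes "A \<in> vcarrier (alg_tensor n X)"
  obtains f where "f \<in> free_space n X" "A = tensor_rel n X `` {f}"
  using assms by (auto simp: alg_tensor_def elim!: quotientE)

text \<open>The span is closed under addition, so the class of the sum is independent of the
  representatives and the union in \<open>alg_tensor\<close> is a single class.\<close>

lemma alg_tensor_add:
  assumes "f \<in> free_space n X" "g \<in> free_space n X"
  shows "vadd (alg_tensor n X) (tensor_rel n X `` {f}) (tensor_rel n X `` {g}) =
    tensor_rel n X `` {f + g}"
proof -
  have "congruent2 (tensor_rel n X) (tensor_rel n X) (\<lambda>f g. tensor_rel n X `` {f + g})"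
  proof (rule congruent2I')
    fix f f' g g' assume "(f, f') \<in> tensor_rel n X" "(g, g') \<in> tensor_rel n X"
    then show "tensor_rel n X `` {f + g} = tensor_rel n X `` {f' + g'}"
      using free.span_add[of "f - f'" "multilinear_relations n X" "g - g'"]
      by (intro tensor_rel_class_eq) (auto simp: tensor_rel_def free_space_add add_diff_add)
  qed
  from UN_equiv_class2[OF equiv_tensor_rel equiv_tensor_rel this assms]
  show ?thesis by (simp add: alg_tensor_def)
qed

lemma alg_tensor_scale:
  assumes "f \<in> free_space n X"
  shows "vscale (alg_tensor n X) c (tensor_rel n X `` {f}) = tensor_rel n X `` {free_scale c f}"
proof -
  have "congruent (tensor_rel n X) (\<lambda>f. tensor_rel n X `` {free_scale c f})"
  proof (rule congruentI)
    fix f f' assume "(f, f') \<in> tensor_rel n X"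
    then show "tensor_rel n X `` {free_scale c f} = tensor_rel n X `` {free_scale c f'}"
      using free.span_scale[of "f - f'" "multilinear_relations n X" c]
      by (intro tensor_rel_class_eq)
        (auto simp: tensor_rel_def free_space_scale free.scale_right_diff_distrib)
  qed
  from UN_equiv_class[OF equiv_tensor_rel this assms]
  show ?thesis by (simp add: alg_tensor_def)
qed

lemma alg_tensor_zero: "vzero (alg_tensor n X) = tensor_rel n X `` {0}"
  by (simp add: alg_tensor_def)

text \<open>Every axiom is checked on representatives, where it is an identity of the free
  space.\<close>

lemma carrier_vector_space_alg_tensor: "carrier_vector_space (alg_tensor n X)"
proof
  fix x y z and c d :: 'a
  let ?A = "alg_tensor n X"
  note simps = alg_tensor_add alg_tensor_scale alg_tensor_zero alg_tensor_carrierI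
    free_space_zero free_space_add free_space_scale free_space_neg
  show "vzero ?A \<in> vcarrier ?A"
    by (simp add: simps)
  assume "x \<in> vcarrier ?A"
  then obtain f where f: "f \<in> free_space n X" "x = tensor_rel n X `` {f}"
    by (rule alg_tensor_carrierE)
  show "vscale ?A c x \<in> vcarrier ?A" "vadd ?A (vzero ?A) x = x" "vscale ?A 1 x = x"
    "vscale ?A (c + d) x = vadd ?A (vscale ?A c x) (vscale ?A d x)"
    "vscale ?A c (vscale ?A d x) = vscale ?A (c * d) x"
    using f by (simp_all add: simps free.scale_left_distrib)
  have "tensor_rel n X `` {free_scale (- 1) f} \<in> vcarrier ?A"
    "vadd ?A x (tensor_rel n X `` {free_scale (- 1) f}) = vzero ?A"
    using f by (simp_all add: simps)
  then show "\<exists>y\<in>vcarrier ?A. vadd ?A x y = vzero ?A"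
    by blast
  assume "y \<in> vcarrier ?A"
  then obtain g where g: "g \<in> free_space n X" "y = tensor_rel n X `` {g}"
    by (rule alg_tensor_carrierE)
  show "vadd ?A x y \<in> vcarrier ?A" "vadd ?A x y = vadd ?A y x"
    "vscale ?A c (vadd ?A x y) = vadd ?A (vscale ?A c x) (vscale ?A c y)"
    using f g by (simp_all add: simps free.scale_right_distrib add.commute)
  assume "z \<in> vcarrier ?A"
  then obtain h where h: "h \<in> free_space n X" "z = tensor_rel n X `` {h}"
    by (rule alg_tensor_carrierE)
  show "vadd ?A (vadd ?A x y) z = vadd ?A x (vadd ?A y z)"
    using f g h by (simp add: simps add.assoc)
qed

lemma tensor_closed: "x \<in> tuples n X \<Longrightarrow> tensor n X x \<in> vcarrier (alg_tensor n X)"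
  by (simp add: tensor_def alg_tensor_carrierI free_space_single)

text \<open>The linear extension of \<open>T\<close> from basis elements to formal combinations. The
  product is a finite sum in \<open>Y\<close>, written through the monoid of
  \<open>comm_monoid_add\<close>.\<close>

definition free_extension ::
  "('k::field, 'b, 'l) vspace_scheme \<Rightarrow> ('c \<Rightarrow> 'b) \<Rightarrow> ('c \<Rightarrow>\<^sub>0 'k) \<Rightarrow> 'b" where
  "free_extension Y T f =
     finprod \<lparr>carrier = vcarrier Y, mult = vadd Y, one = vzero Y\<rparr>
       (\<lambda>x. vscale Y (Poly_Mapping.lookup f x) (T x)) (Poly_Mapping.keys f)"

section \<open>Linearity of the extension to the free space\<close>

context carrier_vector_space
begin

context
  fixes T :: "'c \<Rightarrow> 'a" and S :: "'c set"
  assumes T: "T \<in> S \<rightarrow> vcarrier V"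
begin

interpretation add: comm_monoid "\<lparr>carrier = vcarrier V, mult = vadd V, one = vzero V\<rparr>"
  by (rule comm_monoid_add)

text \<open>Terms outside the support have coefficient zero. Enlarging the index set lets extensions
  of elements with different supports be compared over a common one.\<close>

lemma free_extension_superset:
  assumes "finite A" "Poly_Mapping.keys f \<subseteq> A" "A \<subseteq> S"
  shows "free_extension V T f =
    finprod \<lparr>carrier = vcarrier V, mult = vadd V, one = vzero V\<rparr>
      (\<lambda>x. vscale V (Poly_Mapping.lookup f x) (T x)) A"
  unfolding free_extension_def
  by (rule add.finprod_mono_neutral_cong_left)
    (use assms funcset_mem[OF T] in \<open>auto simp: in_keys_iff scale_zero_left scale_closed\<close>)

lemma free_extension_closed:
  assumes "Poly_Mapping.keys f \<subseteq> S"
  shows "free_extension V T f \<in> vcarrier V"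
proof -
  have "(\<lambda>x. vscale V (Poly_Mapping.lookup f x) (T x)) \<in> Poly_Mapping.keys f \<rightarrow> vcarrier V"
    using assms funcset_mem[OF T] by (auto simp: scale_closed)
  then show ?thesis
    using add.finprod_closed by (simp add: free_extension_def)
qed

lemma free_extension_add:
  assumes f: "Poly_Mapping.keys f \<subseteq> S" and g: "Poly_Mapping.keys g \<subseteq> S"
  shows "free_extension V T (f + g) = vadd V (free_extension V T f) (free_extension V T g)"
proof -
  \<comment> \<open>Cancellation may make the support of \<open>f + g\<close> smaller than this
    union, so all three sums are taken over the union.\<close>
  let ?A = "Poly_Mapping.keys f \<union> Poly_Mapping.keys g"
  let ?G = "\<lparr>carrier = vcarrier V, mult = vadd V, one = vzero V\<rparr>"
  have A: "finite ?A" "?A \<subseteq> S" "Poly_Mapping.keys (f + g) \<subseteq> ?A"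
    using f g Poly_Mapping.keys_add[of f g] by auto
  have T': "T x \<in> vcarrier V" if "x \<in> ?A" for x
    using that A(2) funcset_mem[OF T] by auto
  have "free_extension V T (f + g) =
      finprod ?G (\<lambda>x. vscale V (Poly_Mapping.lookup (f + g) x) (T x)) ?A"
    using A by (intro free_extension_superset) auto
  also have "\<dots> = finprod ?G (\<lambda>x. vadd V (vscale V (Poly_Mapping.lookup f x) (T x))
      (vscale V (Poly_Mapping.lookup g x) (T x))) ?A"
    by (rule add.finprod_cong')
      (use T' in \<open>auto simp: lookup_add scale_add_left scale_closed add_closed\<close>)
  also have "\<dots> = vadd V (finprod ?G (\<lambda>x. vscale V (Poly_Mapping.lookup f x) (T x)) ?A)
      (finprod ?G (\<lambda>x. vscale V (Poly_Mapping.lookup g x) (T x)) ?A)"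
    using add.finprod_multf[of "\<lambda>x. vscale V (Poly_Mapping.lookup f x) (T x)" ?A
        "\<lambda>x. vscale V (Poly_Mapping.lookup g x) (T x)"] T'
    by (simp add: scale_closed Pi_def)
  also have "\<dots> = vadd V (free_extension V T f) (free_extension V T g)"
    using A by (simp add: free_extension_superset[of ?A])
  finally show ?thesis .
qed

lemma free_extension_scale:
  assumes f: "Poly_Mapping.keys f \<subseteq> S"
  shows "free_extension V T (free_scale c f) = vscale V c (free_extension V T f)"
proof -
  let ?G = "\<lparr>carrier = vcarrier V, mult = vadd V, one = vzero V\<rparr>"
  let ?t = "\<lambda>x. vscale V (Poly_Mapping.lookup f x) (T x)"
  have "finprod ?G (\<lambda>x. vscale V c (?t x)) A = vscale V c (finprod ?G ?t A)"
    if "finite A" "A \<subseteq> S" for A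
    using that
  proof (induction A rule: finite_induct)
    case empty
    then show ?case by (simp add: scale_zero_right)
  next
    case (insert a A)
    have t: "?t \<in> A \<rightarrow> vcarrier V" "?t a \<in> vcarrier V"
      using insert.prems funcset_mem[OF T] by (auto simp: scale_closed)
    have ct: "(\<lambda>x. vscale V c (?t x)) \<in> A \<rightarrow> vcarrier V" "vscale V c (?t a) \<in> vcarrier V"
      using t(2) funcset_mem[OF t(1)] by (auto simp: scale_closed)
    have "finprod ?G ?t A \<in> vcarrier V"
      using add.finprod_closed[of ?t A] t by simp
    then show ?case
      using insert t ct add.finprod_insert[of A a ?t] add.finprod_insert[of A a "\<lambda>x. vscale V c (?t x)"]
      by (simp add: scale_add_right)
  qed
  from this[of "Poly_Mapping.keys f"]
  have "vscale V c (free_extension V T f) = finprod ?G (\<lambda>x. vscale V c (?t x)) (Poly_Mapping.keys f)"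
    using f by (simp add: free_extension_def)
  also have "\<dots> = finprod ?G (\<lambda>x. vscale V (Poly_Mapping.lookup (free_scale c f) x) (T x))
      (Poly_Mapping.keys f)"
    by (rule add.finprod_cong')
      (use f funcset_mem[OF T] in \<open>auto simp: lookup_free_scale scale_scale scale_closed\<close>)
  \<comment> \<open>For \<open>c = 0\<close> the support of \<open>free_scale c f\<close> is empty,
    hence the passage through a superset of the support.\<close>
  also have "\<dots> = free_extension V T (free_scale c f)"
    using f by (intro free_extension_superset[symmetric]) (auto simp: in_keys_iff lookup_free_scale)
  finally show ?thesis by simp
qed

lemma free_extension_single:
  assumes "x \<in> S"
  shows "free_extension V T (Poly_Mapping.single x c) = vscale V c (T x)"
proof -
  have "vscale V c (T x) \<in> vcarrier V"
    using assms funcset_mem[OF T] by (auto simp: scale_closed)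
  then show ?thesis
    using free_extension_superset[of "{x}" "Poly_Mapping.single x c"] assms
      add.finprod_insert[of "{}" x "\<lambda>y. vscale V (Poly_Mapping.lookup (Poly_Mapping.single x c) y) (T y)"]
    by (simp add: add_zero_right)
qed

lemma free_extension_diff:
  assumes f: "Poly_Mapping.keys f \<subseteq> S" and g: "Poly_Mapping.keys g \<subseteq> S"
  shows "free_extension V T (f - g) = vdiff V (free_extension V T f) (free_extension V T g)"
proof -
  have "f - g = f + free_scale (- 1) g"
    by simp
  moreover have "Poly_Mapping.keys (free_scale (- 1) g) \<subseteq> S"
    using g by (auto simp: in_keys_iff lookup_free_scale)
  ultimately show ?thesis
    using f g by (simp only: vdiff_def free_extension_add free_extension_scale)
qed

end

end

text \<open>At least one factor is required to receive scalars: for \<open>n = 0\<close> there is a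
  single tuple, and coefficient-free sums of its tensor reach only its natural multiples.\<close>

locale tensor_spaces =
  fixes n :: nat and X :: "nat \<Rightarrow> ('k::field, 'a, 'm) vspace_scheme"
  assumes n_pos: "n \<ge> 1"
    and space: "i \<in> {1..n} \<Longrightarrow> carrier_vector_space (X i)"
begin

lemma one_in: "1 \<in> {1..n}"
  using n_pos by simp

lemma tuples_scale:
  "\<lbrakk>x \<in> tuples n X; i \<in> {1..n}\<rbrakk> \<Longrightarrow> x(i := vscale (X i) c (x i)) \<in> tuples n X"
  by (intro tuples_upd carrier_vector_space.scale_closed[OF space] tuples_carrier)

lemma relations_subset: "multilinear_relations n X \<subseteq> free_space n X"
proof
  fix r assume "r \<in> multilinear_relations n X"
  then show "r \<in> free_space n X"
    by (auto simp: multilinear_relations_def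
        intro!: free_space_diff free_space_scale free_space_single tuples_upd
          carrier_vector_space.add_closed[OF space] carrier_vector_space.scale_closed[OF space])
qed

text \<open>This is the scaling relation with \<open>u = x i\<close>; the trivial update
  \<open>x(i := x i)\<close> brings \<open>x\<close> into the shape required by
  \<open>multilinear_relations\<close>.\<close>

lemma tensor_scale:
  assumes x: "x \<in> tuples n X" and i: "i \<in> {1..n}"
  shows "tensor n X (x(i := vscale (X i) c (x i))) = vscale (alg_tensor n X) c (tensor n X x)"
proof -
  have xi: "x i \<in> vcarrier (X i)"
    using x i by (rule tuples_carrier)
  have "Poly_Mapping.single (x(i := vscale (X i) c (x i))) 1
      - free_scale c (Poly_Mapping.single (x(i := x i)) 1) \<in> multilinear_relations n X"
    unfolding multilinear_relations_def using x i xi by blast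
  then have "Poly_Mapping.single (x(i := vscale (X i) c (x i))) 1
      - free_scale c (Poly_Mapping.single x 1) \<in> free.span (multilinear_relations n X)"
    by (simp add: free.span_base)
  then show ?thesis
    unfolding tensor_def alg_tensor_scale[OF free_space_single[OF x]]
    by (intro tensor_rel_class_eq free_space_scale free_space_single tuples_scale x i)
qed

text \<open>A representative is a finite sum of weighted tuples, and each weight is absorbed into
  the first entry of its tuple. This yields both uniqueness of linear maps given on tensors and
  nonemptiness of the set of costs in \<open>projective_norm\<close>.\<close>

lemma alg_tensor_decomposition:
  assumes z: "z \<in> vcarrier (alg_tensor n X)"
  obtains xs where "set xs \<subseteq> tuples n X" "z = vsum_list (alg_tensor n X) (map (tensor n X) xs)"
proof -
  obtain f where f: "f \<in> free_space n X" "z = tensor_rel n X `` {f}"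
    using z by (rule alg_tensor_carrierE)
  have "\<exists>xs. set xs \<subseteq> tuples n X \<and>
      tensor_rel n X `` {\<Sum>x\<in>A. Poly_Mapping.single x (c x)} =
        vsum_list (alg_tensor n X) (map (tensor n X) xs)"
    if "finite A" "A \<subseteq> tuples n X" for A and c :: "(nat \<Rightarrow> 'a) \<Rightarrow> 'k"
    using that
  proof (induction A rule: finite_induct)
    case empty
    then show ?case
      by (intro exI[of _ "[]"]) (simp add: vsum_list_def alg_tensor_zero)
  next
    case (insert x A)
    then obtain xs where xs: "set xs \<subseteq> tuples n X"
      "tensor_rel n X `` {\<Sum>x\<in>A. Poly_Mapping.single x (c x)} =
        vsum_list (alg_tensor n X) (map (tensor n X) xs)"
      by auto
    have x: "x \<in> tuples n X"
      using insert.prems by simp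
    define y where "y = x(1 := vscale (X 1) (c x) (x 1))"
    have y: "y \<in> tuples n X"
      unfolding y_def using x one_in by (rule tuples_scale)
    have ty: "tensor n X y = tensor_rel n X `` {Poly_Mapping.single x (c x)}"
      unfolding y_def tensor_scale[OF x one_in]
      by (simp add: tensor_def alg_tensor_scale free_space_single x free_scale_single)
    have "(\<Sum>x\<in>A. Poly_Mapping.single x (c x)) \<in> free_space n X"
      using insert.prems by (intro free.subspace_sum[OF subspace_free_space] free_space_single) auto
    then have "tensor_rel n X `` {\<Sum>x\<in>insert x A. Poly_Mapping.single x (c x)} =
        vsum_list (alg_tensor n X) (map (tensor n X) (y # xs))"
      using insert.hyps xs(2)[unfolded vsum_list_def, symmetric]
        alg_tensor_add[OF free_space_single[OF x]]
      by (simp add: vsum_list_def ty)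
    then show ?case
      using xs(1) y by (intro exI[of _ "y # xs"]) simp
  qed
  from this[of "Poly_Mapping.keys f" "Poly_Mapping.lookup f"] f
  show thesis
    using that by (auto simp: free_space_def poly_mapping_sum_singles)
qed

section \<open>The linearization of a multilinear map\<close>

context
  fixes Y :: "('k, 'b, 'l) vspace_scheme" and T :: "(nat \<Rightarrow> 'a) \<Rightarrow> 'b"
  assumes Y: "carrier_vector_space Y" and T: "multilinear_map n X Y T"
begin

interpretation Y: carrier_vector_space Y
  by (rule Y)

lemma multilinear_closed: "T \<in> tuples n X \<rightarrow> vcarrier Y"
  using T by (simp add: multilinear_map_def)

lemma free_extension_relation:
  assumes "r \<in> multilinear_relations n X"
  shows "free_extension Y T r = vzero Y"
proof -
  note ext = Y.free_extension_diff[OF multilinear_closed] Y.free_extension_single[OF multilinear_closed]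
    Y.free_extension_scale[OF multilinear_closed]
  from assms consider
    (add) x i u v where "r = Poly_Mapping.single (x(i := vadd (X i) u v)) 1
        - Poly_Mapping.single (x(i := u)) 1 - Poly_Mapping.single (x(i := v)) 1"
      "x \<in> tuples n X" "i \<in> {1..n}" "u \<in> vcarrier (X i)" "v \<in> vcarrier (X i)"
    | (scale) x i c u where "r = Poly_Mapping.single (x(i := vscale (X i) c u)) 1
        - free_scale c (Poly_Mapping.single (x(i := u)) 1)"
      "x \<in> tuples n X" "i \<in> {1..n}" "u \<in> vcarrier (X i)"
    unfolding multilinear_relations_def by blast
  then show ?thesis
  proof cases
    case add
    let ?a = "x(i := vadd (X i) u v)" and ?b = "x(i := u)" and ?c = "x(i := v)"
    have mem: "?a \<in> tuples n X" "?b \<in> tuples n X" "?c \<in> tuples n X"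
      using add by (auto intro!: tuples_upd carrier_vector_space.add_closed[OF space])
    have TY: "T ?b \<in> vcarrier Y" "T ?c \<in> vcarrier Y"
      using mem multilinear_closed by auto
    have "T ?a = vadd Y (T ?b) (T ?c)"
      using T add by (simp add: multilinear_map_def)
    moreover have "Poly_Mapping.keys (Poly_Mapping.single ?a (1::'k) - Poly_Mapping.single ?b 1)
        \<subseteq> tuples n X"
      using free_space_diff[OF free_space_single[OF mem(1)] free_space_single[OF mem(2)]]
      by (simp add: free_space_def)
    ultimately have "free_extension Y T r =
        vdiff Y (vdiff Y (vadd Y (T ?b) (T ?c)) (T ?b)) (T ?c)"
      unfolding add(1) using mem TY
      by (simp add: ext Y.scale_one Y.add_closed)
    \<comment> \<open>Reading the subtracted \<open>T ?b\<close> as \<open>T ?b\<close> plus zero,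
      \<open>diff_add_add\<close> cancels it and leaves \<open>T ?c\<close> minus itself.\<close>
    also have "\<dots> = vzero Y"
      using Y.diff_add_add[OF TY TY(1) Y.zero_closed] TY
      by (simp add: Y.add_zero_right Y.add_zero Y.diff_self Y.diff_zero)
    finally show ?thesis .
  next
    case scale
    let ?a = "x(i := vscale (X i) c u)" and ?b = "x(i := u)"
    have mem: "?a \<in> tuples n X" "?b \<in> tuples n X"
      using scale by (auto intro!: tuples_upd carrier_vector_space.scale_closed[OF space])
    have TY: "T ?b \<in> vcarrier Y"
      using mem multilinear_closed by auto
    have "T ?a = vscale Y c (T ?b)"
      using T scale by (simp add: multilinear_map_def)
    then show ?thesis
      unfolding scale(1) free_scale_single using mem TY
      by (simp add: ext Y.scale_one Y.scale_closed Y.diff_self)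
  qed
qed

lemma free_extension_span:
  assumes "r \<in> free.span (multilinear_relations n X)"
  shows "free_extension Y T r = vzero Y"
proof -
  \<comment> \<open>The kernel is cut down to \<open>free_space n X\<close>, where additivity and
    homogeneity of the extension are available. A subspace containing the relations contains their
    span.\<close>
  let ?K = "{f \<in> free_space n X. free_extension Y T f = vzero Y}"
  have "free.subspace ?K"
  proof (rule free.subspaceI)
    \<comment> \<open>Zero is written as zero times zero so that homogeneity evaluates the extension
      there.\<close>
    have "free_extension Y T (free_scale 0 0) = vzero Y"
      by (subst Y.free_extension_scale[OF multilinear_closed])
        (auto intro!: Y.scale_zero_left Y.free_extension_closed[OF multilinear_closed])
    then show "0 \<in> ?K"
      by (simp add: free_space_zero)
  qed (auto simp: free_space_add free_space_scale Y.free_extension_add[OF multilinear_closed]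
      Y.free_extension_scale[OF multilinear_closed] Y.add_zero Y.zero_closed Y.scale_zero_right
      free_space_def[THEN eq_refl, THEN subsetD, THEN CollectD])
  moreover have "multilinear_relations n X \<subseteq> ?K"
    using relations_subset free_extension_relation by auto
  ultimately show ?thesis
    using free.span_minimal[of "multilinear_relations n X" ?K] assms by blast
qed

text \<open>Sums of tensors exhaust the carrier by \<open>alg_tensor_decomposition\<close>, and
  linear maps are extensional, so agreement on the carrier is equality of functions.\<close>

lemma linear_map_unique:
  assumes F: "linear_map (alg_tensor n X) Y F" and G: "linear_map (alg_tensor n X) Y G"
    and eq: "\<And>x. x \<in> tuples n X \<Longrightarrow> F (tensor n X x) = G (tensor n X x)"
  shows "F = G"
proof (rule PiE_ext)
  show "F \<in> vcarrier (alg_tensor n X) \<rightarrow>\<^sub>E vcarrier Y" "G \<in> vcarrier (alg_tensor n X) \<rightarrow>\<^sub>E vcarrier Y"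
    using F G by (simp_all add: linear_map_def)
  fix z assume "z \<in> vcarrier (alg_tensor n X)"
  then obtain xs where xs: "set xs \<subseteq> tuples n X"
    "z = vsum_list (alg_tensor n X) (map (tensor n X) xs)"
    by (rule alg_tensor_decomposition)
  then have "set (map (tensor n X) xs) \<subseteq> vcarrier (alg_tensor n X)"
    by (auto intro: tensor_closed)
  then have "F z = vsum_list Y (map F (map (tensor n X) xs))"
    "G z = vsum_list Y (map G (map (tensor n X) xs))"
    unfolding xs(2)
    by (intro linear_map_vsum_list carrier_vector_space_alg_tensor Y F G; assumption)+
  moreover have "map F (map (tensor n X) xs) = map G (map (tensor n X) xs)"
    using xs(1) eq by auto
  ultimately show "F z = G z" by (simp only:)
qed

lemma linear_map_exists:
  "\<exists>F. linear_map (alg_tensor n X) Y F \<and> (\<forall>x\<in>tuples n X. F (tensor n X x) = T x)"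
proof -
  \<comment> \<open>The representative picked by \<open>SOME\<close> does not matter: two of them
    differ by an element of the span, on which the extension vanishes. This is
    \<open>F_eq\<close>.\<close>
  define F where "F = (\<lambda>A\<in>vcarrier (alg_tensor n X). free_extension Y T (SOME f. f \<in> A))"
  have F_eq: "F (tensor_rel n X `` {f}) = free_extension Y T f" if f: "f \<in> free_space n X" for f
  proof -
    define g where "g = (SOME g. g \<in> tensor_rel n X `` {f})"
    have "g \<in> tensor_rel n X `` {f}"
      unfolding g_def using equiv_class_self[OF equiv_tensor_rel f] by (rule someI)
    then have g: "g \<in> free_space n X" "f - g \<in> free.span (multilinear_relations n X)"
      by (auto simp: tensor_rel_def)
    have K: "Poly_Mapping.keys f \<subseteq> tuples n X" "Poly_Mapping.keys g \<subseteq> tuples n X"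
      using f g by (auto simp: free_space_def)
    have "free_extension Y T f = free_extension Y T g"
      by (rule Y.eq_of_diff_zero)
        (use free_extension_span[OF g(2)] K in \<open>simp_all add: Y.free_extension_diff[OF multilinear_closed]
          Y.free_extension_closed[OF multilinear_closed]\<close>)
    then show ?thesis
      using alg_tensor_carrierI[OF f] by (simp add: F_def g_def)
  qed
  have keys: "Poly_Mapping.keys f \<subseteq> tuples n X" if "f \<in> free_space n X" for f
    using that by (simp add: free_space_def)
  have "linear_map (alg_tensor n X) Y F"
    unfolding linear_map_def
  proof (intro conjI ballI allI)
    show "F \<in> vcarrier (alg_tensor n X) \<rightarrow>\<^sub>E vcarrier Y"
    proof (rule PiE_I)
      fix A assume "A \<in> vcarrier (alg_tensor n X)"
      then show "F A \<in> vcarrier Y"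
        by (auto elim!: alg_tensor_carrierE
            simp: F_eq Y.free_extension_closed[OF multilinear_closed] keys)
    qed (simp add: F_def)
  next
    fix A B assume "A \<in> vcarrier (alg_tensor n X)" "B \<in> vcarrier (alg_tensor n X)"
    then obtain f g where "f \<in> free_space n X" "A = tensor_rel n X `` {f}"
      "g \<in> free_space n X" "B = tensor_rel n X `` {g}"
      by (metis alg_tensor_carrierE)
    then show "F (vadd (alg_tensor n X) A B) = vadd Y (F A) (F B)"
      by (simp add: alg_tensor_add F_eq free_space_add keys
          Y.free_extension_add[OF multilinear_closed])
  next
    fix c A assume "A \<in> vcarrier (alg_tensor n X)"
    then show "F (vscale (alg_tensor n X) c A) = vscale Y c (F A)"
      by (auto elim!: alg_tensor_carrierE simp: alg_tensor_scale F_eq free_space_scale keys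
          Y.free_extension_scale[OF multilinear_closed])
  qed
  moreover have "F (tensor n X x) = T x" if x: "x \<in> tuples n X" for x
    using funcset_mem[OF multilinear_closed x] x
    by (auto simp: tensor_def F_eq free_space_single Y.free_extension_single[OF multilinear_closed]
        Y.scale_one)
  ultimately show ?thesis by blast
qed

text \<open>Existence and uniqueness give meaning to the description in
  \<open>linearization\<close>; from here on only these two properties of it are used.\<close>

lemma linearization:
  shows linear_map_linearization: "linear_map (alg_tensor n X) Y (linearization n X Y T)"
    and linearization_tensor: "x \<in> tuples n X \<Longrightarrow> linearization n X Y T (tensor n X x) = T x"
proof -
  have "\<exists>!F. linear_map (alg_tensor n X) Y F \<and> (\<forall>x\<in>tuples n X. F (tensor n X x) = T x)"
    using linear_map_exists by (rule ex_ex1I) (auto intro: linear_map_unique)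
  from theI'[OF this]
  show "linear_map (alg_tensor n X) Y (linearization n X Y T)"
    and "x \<in> tuples n X \<Longrightarrow> linearization n X Y T (tensor n X x) = T x"
    by (simp_all add: linearization_def)
qed

lemma multilinear_scale:
  assumes x: "x \<in> tuples n X" and i: "i \<in> {1..n}"
  shows "T (x(i := vscale (X i) c (x i))) = vscale Y c (T x)"
  using T x i tuples_carrier[OF x i] unfolding multilinear_map_def
  by (metis fun_upd_triv)

lemma multilinear_zero:
  assumes x: "x \<in> tuples n X" and i: "i \<in> {1..n}" and 0: "x i = vzero (X i)"
  shows "T x = vzero Y"
proof -
  \<comment> \<open>A zero entry is zero times itself, so the scalar zero can be taken out of
    \<open>T\<close>.\<close>
  have "x(i := vscale (X i) 0 (x i)) = x"
    using carrier_vector_space.scale_zero_right[OF space[OF i], of 0] 0 by (simp add: fun_upd_idem)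
  then show ?thesis
    using multilinear_scale[OF x i, of 0] funcset_mem[OF multilinear_closed x] Y.scale_zero_left by simp
qed

text \<open>Induction over the set of rescaled positions. Membership in \<open>tuples n X\<close> is
  part of the claim because the next scalar is taken out of the partially rescaled tuple.\<close>

lemma multilinear_scale_prod:
  assumes x: "x \<in> tuples n X" and J: "J \<subseteq> {1..n}"
  shows "(\<lambda>i. if i \<in> J then vscale (X i) (c i) (x i) else x i) \<in> tuples n X \<and>
    T (\<lambda>i. if i \<in> J then vscale (X i) (c i) (x i) else x i) = vscale Y (\<Prod>i\<in>J. c i) (T x)"
  using finite_subset[OF J finite_atLeastAtMost] J
proof (induction J rule: finite_induct)
  case empty
  then show ?case
    using x funcset_mem[OF multilinear_closed x] Y.scale_one by simp
next
  case (insert j J)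
  let ?y = "\<lambda>i. if i \<in> J then vscale (X i) (c i) (x i) else x i"
  have IH: "?y \<in> tuples n X" "T ?y = vscale Y (\<Prod>i\<in>J. c i) (T x)" and j: "j \<in> {1..n}"
    using insert by auto
  have eq: "(\<lambda>i. if i \<in> insert j J then vscale (X i) (c i) (x i) else x i) =
      ?y(j := vscale (X j) (c j) (?y j))"
    using insert.hyps by auto
  show ?case
    unfolding eq multilinear_scale[OF IH(1) j] IH(2)
    using insert.hyps funcset_mem[OF multilinear_closed x] tuples_carrier[OF IH(1) j]
    by (auto intro!: tuples_upd IH j carrier_vector_space.scale_closed[OF space] simp: Y.scale_scale)
qed

end

end

section \<open>The projective norm\<close>

locale normed_tensor_spaces =
  fixes n :: nat and X :: "nat \<Rightarrow> ('k::real_normed_field, 'a, 'm) nspace_scheme"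
  assumes n_ge_1: "n \<ge> 1"
    and normed_space: "i \<in> {1..n} \<Longrightarrow> carrier_normed_space (X i)"

sublocale normed_tensor_spaces \<subseteq> tensor_spaces n X
  using n_ge_1 carrier_normed_space.axioms(1)[OF normed_space] by (rule tensor_spaces.intro)

lemma projective_tensor_simps [simp]:
  "vcarrier (projective_tensor n X) = vcarrier (alg_tensor n X)"
  "vadd (projective_tensor n X) = vadd (alg_tensor n X)"
  "vzero (projective_tensor n X) = vzero (alg_tensor n X)"
  "vscale (projective_tensor n X) = vscale (alg_tensor n X)"
  "vnorm (projective_tensor n X) = projective_norm n X"
  by (simp_all add: projective_tensor_def vspace.defs nspace.defs)

lemma linear_map_projective_tensor:
  "linear_map (projective_tensor n X) Y F \<longleftrightarrow> linear_map (alg_tensor n X) Y F"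
  by (simp add: linear_map_def)

context normed_tensor_spaces
begin

definition norm_prod :: "(nat \<Rightarrow> 'a) \<Rightarrow> real" where
  "norm_prod x = (\<Prod>i=1..n. vnorm (X i) (x i))"

lemma vnorm_nonneg: "\<lbrakk>x \<in> tuples n X; i \<in> {1..n}\<rbrakk> \<Longrightarrow> 0 \<le> vnorm (X i) (x i)"
  by (intro carrier_normed_space.norm_nonneg normed_space tuples_carrier)

lemma norm_prod_nonneg: "x \<in> tuples n X \<Longrightarrow> 0 \<le> norm_prod x"
  unfolding norm_prod_def by (intro prod_nonneg ballI vnorm_nonneg)

lemma norm_prod_scale:
  assumes x: "x \<in> tuples n X" and i: "i \<in> {1..n}"
  shows "norm_prod (x(i := vscale (X i) c (x i))) = norm c * norm_prod x"
proof -
  have "norm_prod (x(i := vscale (X i) c (x i))) =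
      vnorm (X i) (vscale (X i) c (x i)) * (\<Prod>j\<in>{1..n} - {i}. vnorm (X j) (x j))"
    unfolding norm_prod_def using i by (subst prod.remove[of _ i]) auto
  also have "\<dots> = norm c * (vnorm (X i) (x i) * (\<Prod>j\<in>{1..n} - {i}. vnorm (X j) (x j)))"
    using carrier_normed_space.norm_scale[OF normed_space[OF i] tuples_carrier[OF x i]] by simp
  also have "\<dots> = norm c * norm_prod x"
    unfolding norm_prod_def using i by (simp add: prod.remove[of _ i])
  finally show ?thesis .
qed

lemma cost_nonneg: "set xs \<subseteq> tuples n X \<Longrightarrow> 0 \<le> (\<Sum>x\<leftarrow>xs. norm_prod x)"
  by (rule sum_list_nonneg) (auto simp: norm_prod_nonneg)

lemma projective_norm_le:
  assumes "set xs \<subseteq> tuples n X"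
  shows "projective_norm n X (vsum_list (alg_tensor n X) (map (tensor n X) xs)) \<le>
    (\<Sum>x\<leftarrow>xs. norm_prod x)"
  unfolding projective_norm_def norm_prod_def[symmetric]
proof (rule cInf_lower)
  show "bdd_below {\<Sum>x\<leftarrow>ys. norm_prod x | ys. set ys \<subseteq> tuples n X \<and>
      vsum_list (alg_tensor n X) (map (tensor n X) xs) =
      vsum_list (alg_tensor n X) (map (tensor n X) ys)}"
    by (rule bdd_belowI[of _ 0]) (auto intro: cost_nonneg)
qed (use assms in blast)

text \<open>A lower bound for all costs passes to the real infimum only if some representation
  exists, which \<open>alg_tensor_decomposition\<close> guarantees.\<close>

lemma projective_norm_ge:
  assumes z: "z \<in> vcarrier (alg_tensor n X)"
    and "\<And>xs. \<lbrakk>set xs \<subseteq> tuples n X; z = vsum_list (alg_tensor n X) (map (tensor n X) xs)\<rbrakk>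
      \<Longrightarrow> m \<le> (\<Sum>x\<leftarrow>xs. norm_prod x)"
  shows "m \<le> projective_norm n X z"
proof -
  obtain xs where "set xs \<subseteq> tuples n X" "z = vsum_list (alg_tensor n X) (map (tensor n X) xs)"
    using z by (rule alg_tensor_decomposition)
  then show ?thesis
    unfolding projective_norm_def norm_prod_def[symmetric] by (intro cInf_greatest) (use assms(2) in blast)+
qed

lemma projective_norm_tensor_le:
  assumes "x \<in> tuples n X"
  shows "projective_norm n X (tensor n X x) \<le> norm_prod x"
  using projective_norm_le[of "[x]"] assms
    carrier_vector_space.add_zero_right[OF carrier_vector_space_alg_tensor tensor_closed[OF assms]]
  by (simp add: vsum_list_def)

lemma projective_norm_nonneg: "z \<in> vcarrier (alg_tensor n X) \<Longrightarrow> 0 \<le> projective_norm n X z"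
  by (rule projective_norm_ge) (auto intro: cost_nonneg)

text \<open>Concatenating representations of \<open>w\<close> and \<open>z\<close> represents the
  sum, at the sum of the costs.\<close>

lemma projective_norm_triangle:
  assumes w: "w \<in> vcarrier (alg_tensor n X)" and z: "z \<in> vcarrier (alg_tensor n X)"
  shows "projective_norm n X (vadd (alg_tensor n X) w z) \<le> projective_norm n X w + projective_norm n X z"
proof -
  let ?A = "alg_tensor n X"
  have le: "projective_norm n X (vadd ?A w z) \<le> (\<Sum>x\<leftarrow>xs. norm_prod x) + (\<Sum>x\<leftarrow>ys. norm_prod x)"
    if "set xs \<subseteq> tuples n X" "w = vsum_list ?A (map (tensor n X) xs)"
      "set ys \<subseteq> tuples n X" "z = vsum_list ?A (map (tensor n X) ys)" for xs ys
  proof -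
    have "set (map (tensor n X) xs) \<subseteq> vcarrier ?A" "set (map (tensor n X) ys) \<subseteq> vcarrier ?A"
      using that by (auto intro: tensor_closed)
    then have "vadd ?A w z = vsum_list ?A (map (tensor n X) (xs @ ys))"
      unfolding that map_append
      by (rule carrier_vector_space.vsum_list_append[OF carrier_vector_space_alg_tensor, symmetric])
    then show ?thesis
      using projective_norm_le[of "xs @ ys"] that by simp
  qed
  \<comment> \<open>The two infima are taken one at a time: the inner use of
    \<open>projective_norm_ge\<close> varies the representation of \<open>w\<close>, the outer one
    that of \<open>z\<close>.\<close>
  have "projective_norm n X (vadd ?A w z) - projective_norm n X w \<le> projective_norm n X z"
  proof (rule projective_norm_ge[OF z])
    fix ys assume ys: "set ys \<subseteq> tuples n X" "z = vsum_list ?A (map (tensor n X) ys)"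
    have "projective_norm n X (vadd ?A w z) - (\<Sum>x\<leftarrow>ys. norm_prod x) \<le> projective_norm n X w"
      by (rule projective_norm_ge[OF w]) (use le[OF _ _ ys] in force)
    then show "projective_norm n X (vadd ?A w z) - projective_norm n X w \<le> (\<Sum>x\<leftarrow>ys. norm_prod x)"
      by simp
  qed
  then show ?thesis by simp
qed

text \<open>Scaling the first entry of each tuple turns a representation of \<open>z\<close> into
  one of its multiple, and each cost is multiplied by \<open>norm c\<close>.\<close>

lemma projective_norm_scale_le:
  assumes z: "z \<in> vcarrier (alg_tensor n X)"
  shows "projective_norm n X (vscale (alg_tensor n X) c z) \<le> norm c * projective_norm n X z"
proof -
  interpret A: carrier_vector_space "alg_tensor n X"
    by (rule carrier_vector_space_alg_tensor)
  have le: "projective_norm n X (vscale (alg_tensor n X) c z) \<le> norm c * (\<Sum>x\<leftarrow>xs. norm_prod x)"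
    if xs: "set xs \<subseteq> tuples n X" "z = vsum_list (alg_tensor n X) (map (tensor n X) xs)" for xs
  proof -
    let ?s = "\<lambda>x. x(1 := vscale (X 1) c (x 1))"
    have "set (map (tensor n X) xs) \<subseteq> vcarrier (alg_tensor n X)"
      using xs by (auto intro: tensor_closed)
    then have "vscale (alg_tensor n X) c z =
        vsum_list (alg_tensor n X) (map (vscale (alg_tensor n X) c) (map (tensor n X) xs))"
      unfolding xs by (rule A.vsum_list_scale)
    also have "map (vscale (alg_tensor n X) c) (map (tensor n X) xs) = map (tensor n X) (map ?s xs)"
      using xs(1) tensor_scale[OF _ one_in] by auto
    finally have "vscale (alg_tensor n X) c z =
        vsum_list (alg_tensor n X) (map (tensor n X) (map ?s xs))" .
    moreover have "set (map ?s xs) \<subseteq> tuples n X"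
      using xs(1) tuples_scale[OF _ one_in] by auto
    ultimately have "projective_norm n X (vscale (alg_tensor n X) c z) \<le>
        (\<Sum>x\<leftarrow>map ?s xs. norm_prod x)"
      using projective_norm_le[of "map ?s xs"] by (simp only:)
    also have "map norm_prod (map ?s xs) = map (\<lambda>x. norm c * norm_prod x) xs"
      unfolding map_map by (rule map_cong) (use xs(1) norm_prod_scale[OF _ one_in] in auto)
    finally show ?thesis
      by (simp only: sum_list_const_mult)
  qed
  show ?thesis
  proof (cases "c = 0")
    \<comment> \<open>Division by \<open>norm c\<close> is impossible here, but any one
      representation of \<open>z\<close> already gives the bound zero.\<close>
    case True
    then show ?thesis
      using alg_tensor_decomposition[OF z] le by force
  next
    case False
    then have "projective_norm n X (vscale (alg_tensor n X) c z) / norm c \<le> projective_norm n X z"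
      by (intro projective_norm_ge[OF z]) (use le in \<open>simp add: pos_divide_le_eq mult.commute\<close>)
    then show ?thesis
      using False by (simp add: pos_divide_le_eq mult.commute)
  qed
qed

text \<open>The missing inequality is \<open>projective_norm_scale_le\<close> for
  \<open>inverse c\<close>, applied to the scaled tensor.\<close>

lemma projective_norm_scale:
  assumes z: "z \<in> vcarrier (alg_tensor n X)"
  shows "projective_norm n X (vscale (alg_tensor n X) c z) = norm c * projective_norm n X z"
proof (rule antisym[OF projective_norm_scale_le[OF z]])
  interpret A: carrier_vector_space "alg_tensor n X"
    by (rule carrier_vector_space_alg_tensor)
  have cz: "vscale (alg_tensor n X) c z \<in> vcarrier (alg_tensor n X)"
    using z by (rule A.scale_closed)
  show "norm c * projective_norm n X z \<le> projective_norm n X (vscale (alg_tensor n X) c z)"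
  proof (cases "c = 0")
    case True
    then show ?thesis
      using projective_norm_nonneg[OF cz] by simp
  next
    case False
    then have "z = vscale (alg_tensor n X) (inverse c) (vscale (alg_tensor n X) c z)"
      using z by (simp add: A.scale_scale A.scale_one)
    then have "projective_norm n X z \<le> norm (inverse c) * projective_norm n X (vscale (alg_tensor n X) c z)"
      using projective_norm_scale_le[OF cz, of "inverse c"] by (simp only:)
    then show ?thesis
      unfolding norm_inverse using False by (simp add: field_simps)
  qed
qed

lemma carrier_seminormed_space_projective_tensor:
  "carrier_seminormed_space (projective_tensor n X)"
proof -
  have "carrier_vector_space (projective_tensor n X)"
    using carrier_vector_space_alg_tensor[of n X]
    unfolding carrier_vector_space_def projective_tensor_simps .
  then show ?thesis
    by (simp add: carrier_seminormed_space_def carrier_seminormed_space_axioms_def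
        projective_norm_nonneg projective_norm_scale projective_norm_triangle)
qed

section \<open>Boundedness, Lipschitz constants and norms of the linearization\<close>

context
  fixes Y :: "('k, 'b, 'l) nspace_scheme" and T :: "(nat \<Rightarrow> 'a) \<Rightarrow> 'b"
  assumes Y: "carrier_normed_space Y" and T: "multilinear_map n X Y T"
begin

interpretation Y: carrier_normed_space Y
  by (rule Y)

interpretation P: carrier_seminormed_space "projective_tensor n X"
  by (rule carrier_seminormed_space_projective_tensor)

lemma multilinear_mem: "x \<in> tuples n X \<Longrightarrow> T x \<in> vcarrier Y"
  using multilinear_closed[OF Y.carrier_vector_space_axioms T] by (rule funcset_mem)

lemma linear_map_projective_linearization: "linear_map (projective_tensor n X) Y (linearization n X Y T)"
  unfolding linear_map_projective_tensor
  by (rule linear_map_linearization[OF Y.carrier_vector_space_axioms T])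

lemma linearization_eq: "x \<in> tuples n X \<Longrightarrow> linearization n X Y T (tensor n X x) = T x"
  by (rule linearization_tensor[OF Y.carrier_vector_space_axioms T])

lemma multilinear_bound:
  assumes M: "\<And>x. x \<in> unit_tuples n X \<Longrightarrow> vnorm Y (T x) \<le> M" and x: "x \<in> tuples n X"
  shows "vnorm Y (T x) \<le> M * norm_prod x"
proof (cases "\<exists>i\<in>{1..n}. vnorm (X i) (x i) = 0")
  \<comment> \<open>An entry of norm zero cannot be normalised, but then both sides of the
    inequality vanish.\<close>
  case True
  then obtain i where i: "i \<in> {1..n}" "vnorm (X i) (x i) = 0"
    by blast
  then have "x i = vzero (X i)"
    using carrier_normed_space.norm_eq_zero_iff[OF normed_space[OF i(1)] tuples_carrier[OF x i(1)]]
    by simp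
  then have "T x = vzero Y"
    by (rule multilinear_zero[OF Y.carrier_vector_space_axioms T x i(1)])
  moreover have "norm_prod x = 0"
    unfolding norm_prod_def using i by (intro prod_zero) auto
  ultimately show ?thesis
    by (simp add: Y.seminorm_zero)
next
  case False
  then have pos: "vnorm (X i) (x i) > 0" if "i \<in> {1..n}" for i
    using vnorm_nonneg[OF x that] that by force
  \<comment> \<open>These scalars bring each entry to norm exactly 1. Since the norm of the field is
    multiplicative, their product has norm \<open>inverse (norm_prod x)\<close>.\<close>
  define c where "c i = (of_real (inverse (vnorm (X i) (x i))) :: 'k)" for i
  have c: "norm (c i) = inverse (vnorm (X i) (x i))" if "i \<in> {1..n}" for i
    unfolding c_def norm_of_real using pos[OF that] by simp
  define y where "y = (\<lambda>i. if i \<in> {1..n} then vscale (X i) (c i) (x i) else x i)"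
  have y: "y \<in> tuples n X" "T y = vscale Y (\<Prod>i\<in>{1..n}. c i) (T x)"
    using multilinear_scale_prod[OF Y.carrier_vector_space_axioms T x order.refl, of c]
    by (simp_all add: y_def)
  have "vnorm (X i) (y i) = 1" if i: "i \<in> {1..n}" for i
    using carrier_normed_space.norm_scale[OF normed_space[OF i] tuples_carrier[OF x i]] pos[OF i] c[OF i] i
    by (simp add: y_def)
  then have "vnorm Y (T y) \<le> M"
    using y(1) by (intro M) (simp add: unit_tuples_def)
  moreover have "norm (\<Prod>i\<in>{1..n}. c i) = inverse (norm_prod x)"
    unfolding norm_prod_def prod_norm[symmetric] prod_inversef[symmetric]
    using c by (intro prod.cong) auto
  ultimately have "inverse (norm_prod x) * vnorm Y (T x) \<le> M"
    by (simp add: y(2) Y.norm_scale multilinear_mem x)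
  moreover have "norm_prod x > 0"
    unfolding norm_prod_def using pos by (intro prod_pos) auto
  ultimately show ?thesis
    by (simp add: field_simps)
qed

lemma linearization_bound:
  assumes M: "\<And>x. x \<in> unit_tuples n X \<Longrightarrow> vnorm Y (T x) \<le> M"
    and z: "z \<in> vcarrier (alg_tensor n X)" and "M \<ge> 0"
  shows "vnorm Y (linearization n X Y T z) \<le> M * projective_norm n X z"
proof -
  let ?F = "linearization n X Y T"
  have le: "vnorm Y (?F z) \<le> M * (\<Sum>x\<leftarrow>xs. norm_prod x)"
    if xs: "set xs \<subseteq> tuples n X" "z = vsum_list (alg_tensor n X) (map (tensor n X) xs)" for xs
  proof -
    have "set (map (tensor n X) xs) \<subseteq> vcarrier (alg_tensor n X)"
      using xs by (auto intro: tensor_closed)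
    then have "?F z = vsum_list Y (map ?F (map (tensor n X) xs))"
      unfolding xs
      by (rule linear_map_vsum_list[OF carrier_vector_space_alg_tensor Y.carrier_vector_space_axioms
            linear_map_linearization[OF Y.carrier_vector_space_axioms T]])
    also have "map ?F (map (tensor n X) xs) = map T xs"
      using xs(1) linearization_eq by auto
    finally have "vnorm Y (?F z) \<le> (\<Sum>y\<leftarrow>map T xs. vnorm Y y)"
      using Y.vnorm_vsum_list_le[of "map T xs"] xs(1) multilinear_mem by auto
    also have "\<dots> = (\<Sum>x\<leftarrow>xs. vnorm Y (T x))"
      by (simp add: o_def)
    also have "\<dots> \<le> (\<Sum>x\<leftarrow>xs. M * norm_prod x)"
      by (rule sum_list_mono) (use xs(1) multilinear_bound[OF M] in auto)
    finally show ?thesis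
      by (simp only: sum_list_const_mult)
  qed
  show ?thesis
  proof (cases "M = 0")
    \<comment> \<open>The infimum is reached below by dividing by \<open>M\<close>; for
      \<open>M = 0\<close> a single representation suffices.\<close>
    case True
    then show ?thesis
      using alg_tensor_decomposition[OF z] le by force
  next
    case False
    then have "vnorm Y (?F z) / M \<le> projective_norm n X z"
      using \<open>M \<ge> 0\<close>
      by (intro projective_norm_ge[OF z]) (use le in \<open>simp add: pos_divide_le_eq mult.commute\<close>)
    then show ?thesis
      using False \<open>M \<ge> 0\<close> by (simp add: pos_divide_le_eq mult.commute)
  qed
qed

text \<open>Shows that the supremum in \<open>multilinear_norm\<close> is over a nonempty set, and
  supplies the tuple whose tensor is zero.\<close>

lemma zero_tuple: "(\<lambda>i\<in>{1..n}. vzero (X i)) \<in> unit_tuples n X"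
  using carrier_vector_space.zero_closed[OF space]
    carrier_normed_space.norm_eq_zero_iff[OF normed_space carrier_vector_space.zero_closed[OF space]]
  by (simp add: unit_tuples_def tuples_def)

lemma multilinear_norm_upper:
  assumes "bounded_multilinear_map n X Y T" "x \<in> unit_tuples n X"
  shows "vnorm Y (T x) \<le> multilinear_norm n X Y T"
  using assms unfolding bounded_multilinear_map_def multilinear_norm_def
  by (intro cSUP_upper) auto

lemma multilinear_norm_nonneg:
  assumes "bounded_multilinear_map n X Y T"
  shows "0 \<le> multilinear_norm n X Y T"
proof -
  have "0 \<le> vnorm Y (T (\<lambda>i\<in>{1..n}. vzero (X i)))"
    using zero_tuple by (intro Y.norm_nonneg multilinear_mem) (simp add: unit_tuples_def)
  then show ?thesis
    using multilinear_norm_upper[OF assms zero_tuple] by linarith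
qed

lemma bounded_linear_map_linearization:
  assumes "bounded_multilinear_map n X Y T"
  shows "bounded_linear_map (projective_tensor n X) Y (linearization n X Y T)"
  using linearization_bound[OF multilinear_norm_upper[OF assms] _ multilinear_norm_nonneg[OF assms]]
    linear_map_projective_linearization
  by (auto simp: bounded_linear_map_def)

lemma norm_dist_linearization_le:
  assumes M: "\<And>z. z \<in> vcarrier (projective_tensor n X) \<Longrightarrow>
      vnorm Y (linearization n X Y T z) \<le> M * vnorm (projective_tensor n X) z"
    and wz: "w \<in> vcarrier (projective_tensor n X)" "z \<in> vcarrier (projective_tensor n X)"
  shows "norm_dist Y (linearization n X Y T w) (linearization n X Y T z) \<le>
    M * norm_dist (projective_tensor n X) w z"
  using M[OF P.diff_closed[OF wz]] linear_map_diff[OF linear_map_projective_linearization wz P.scale_closed[OF wz(2)]]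
  by (simp add: norm_dist_def)

lemma lipschitz_const_if_bound:
  assumes M: "\<And>z. z \<in> vcarrier (projective_tensor n X) \<Longrightarrow>
      vnorm Y (linearization n X Y T z) \<le> M * vnorm (projective_tensor n X) z"
    and "M \<ge> 0"
  shows "lipschitz_const (decomposable_tensors n X) (norm_dist (projective_tensor n X)) (norm_dist Y)
    (decomposable_restriction n X Y T) M"
  unfolding lipschitz_const_def decomposable_restriction_def
  using \<open>M \<ge> 0\<close> norm_dist_linearization_le[OF M]
  by (auto simp: decomposable_tensors_def tensor_closed)

text \<open>The zero tensor is decomposable because \<open>n \<ge> 1\<close>, so the Lipschitz condition compares any
  decomposable tensor with it.\<close>

lemma unit_bound_if_lipschitz_const:
  assumes L: "lipschitz_const (decomposable_tensors n X) (norm_dist (projective_tensor n X))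
      (norm_dist Y) (decomposable_restriction n X Y T) L"
    and x: "x \<in> unit_tuples n X"
  shows "vnorm Y (T x) \<le> L"
proof -
  let ?z = "\<lambda>i\<in>{1..n}. vzero (X i)" and ?F = "linearization n X Y T"
  have L0: "L \<ge> 0"
    using L by (simp add: lipschitz_const_def)
  have xt: "x \<in> tuples n X" and zt: "?z \<in> tuples n X"
    using x zero_tuple by (auto simp: unit_tuples_def)
  have "?z 1 = vzero (X 1)"
    using one_in by simp
  then have Tz: "T ?z = vzero Y"
    by (rule multilinear_zero[OF Y.carrier_vector_space_axioms T zt one_in])
  \<comment> \<open>The zero tuple is its own rescaling by 0 in the first entry, so by
    \<open>tensor_scale\<close> its tensor is 0 times itself.\<close>
  have "?z(1 := vscale (X 1) 0 (?z 1)) = ?z"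
    using carrier_vector_space.scale_zero_right[OF space[OF one_in], of 0] one_in
    by (simp add: fun_upd_idem)
  then have tz: "tensor n X ?z = vzero (projective_tensor n X)"
    using tensor_scale[OF zt one_in, of 0] P.scale_zero_left[of "tensor n X ?z"] tensor_closed[OF zt]
    by simp
  have "norm_dist Y (?F (tensor n X x)) (?F (tensor n X ?z)) \<le>
      L * norm_dist (projective_tensor n X) (tensor n X x) (tensor n X ?z)"
    using L xt zt by (auto simp: lipschitz_const_def decomposable_restriction_def decomposable_tensors_def)
  then have "vnorm Y (T x) \<le> L * projective_norm n X (tensor n X x)"
    unfolding linearization_eq[OF xt] linearization_eq[OF zt] Tz Y.norm_dist_zero[OF multilinear_mem[OF xt]]
    unfolding tz using P.norm_dist_zero[of "tensor n X x"] tensor_closed[OF xt] by simp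
  also have "\<dots> \<le> L * norm_prod x"
    by (rule mult_left_mono[OF projective_norm_tensor_le[OF xt] L0])
  also have "\<dots> \<le> L * 1"
    unfolding norm_prod_def
    by (rule mult_left_mono[OF prod_le_1 L0])
      (use x in \<open>auto simp: unit_tuples_def vnorm_nonneg\<close>)
  finally show ?thesis by simp
qed

lemma bounded_multilinear_map_if_lipschitz_const:
  assumes "lipschitz_const (decomposable_tensors n X) (norm_dist (projective_tensor n X))
      (norm_dist Y) (decomposable_restriction n X Y T) L"
  shows "bounded_multilinear_map n X Y T"
  unfolding bounded_multilinear_map_def
  using T unit_bound_if_lipschitz_const[OF assms] by (intro conjI bdd_aboveI2)

lemma multilinear_norm_le:
  "(\<And>x. x \<in> unit_tuples n X \<Longrightarrow> vnorm Y (T x) \<le> M) \<Longrightarrow> multilinear_norm n X Y T \<le> M"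
  unfolding multilinear_norm_def using zero_tuple by (intro cSUP_least) auto

text \<open>Supplies the witness for the Lipschitz property and, later, the element at which the
  minimum in \<open>lipschitz_norm\<close> is attained.\<close>

lemma lipschitz_const_operator_norm:
  assumes "bounded_linear_map (projective_tensor n X) Y (linearization n X Y T)"
  shows "lipschitz_const (decomposable_tensors n X) (norm_dist (projective_tensor n X)) (norm_dist Y)
    (decomposable_restriction n X Y T) (operator_norm (projective_tensor n X) Y (linearization n X Y T))"
  using P.norm_le_operator_norm[OF assms Y.carrier_seminormed_space_axioms]
    P.operator_norm_nonneg[OF assms Y.carrier_seminormed_space_axioms]
  by (rule lipschitz_const_if_bound)

text \<open>Passing through the Lipschitz property makes the three conditions a cycle of
  implications.\<close>

lemma bounded_multilinear_map_if_linearization: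
  assumes "bounded_linear_map (projective_tensor n X) Y (linearization n X Y T)"
  shows "bounded_multilinear_map n X Y T"
  using lipschitz_const_operator_norm[OF assms] by (rule bounded_multilinear_map_if_lipschitz_const)

text \<open>The operator norm is a Lipschitz constant and so bounds \<open>T\<close> on unit tuples;
  conversely, \<open>linearization_bound\<close> applies with the norm of \<open>T\<close> as
  constant.\<close>

lemma multilinear_norm_eq_operator_norm:
  assumes b: "bounded_multilinear_map n X Y T"
  shows "multilinear_norm n X Y T = operator_norm (projective_tensor n X) Y (linearization n X Y T)"
proof (rule antisym)
  show "multilinear_norm n X Y T \<le> operator_norm (projective_tensor n X) Y (linearization n X Y T)"
    using lipschitz_const_operator_norm[OF bounded_linear_map_linearization[OF b]]
    by (intro multilinear_norm_le unit_bound_if_lipschitz_const)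
  show "operator_norm (projective_tensor n X) Y (linearization n X Y T) \<le> multilinear_norm n X Y T"
    using linearization_bound[OF multilinear_norm_upper[OF b] _ multilinear_norm_nonneg[OF b]]
    by (intro operator_norm_le carrier_seminormed_space_projective_tensor
        multilinear_norm_nonneg[OF b]) simp
qed

text \<open>The operator norm is itself a Lipschitz constant. Any other one bounds \<open>T\<close>
  on unit tuples, hence bounds the norm of \<open>T\<close>, which equals the operator norm.\<close>

lemma lipschitz_norm_eq_operator_norm:
  assumes b: "bounded_multilinear_map n X Y T"
  shows "lipschitz_norm (decomposable_tensors n X) (norm_dist (projective_tensor n X)) (norm_dist Y)
    (decomposable_restriction n X Y T) = operator_norm (projective_tensor n X) Y (linearization n X Y T)"
  unfolding lipschitz_norm_def
proof (rule Least_equality)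
  show "lipschitz_const (decomposable_tensors n X) (norm_dist (projective_tensor n X)) (norm_dist Y)
      (decomposable_restriction n X Y T) (operator_norm (projective_tensor n X) Y (linearization n X Y T))"
    by (rule lipschitz_const_operator_norm[OF bounded_linear_map_linearization[OF b]])
next
  fix L
  assume "lipschitz_const (decomposable_tensors n X) (norm_dist (projective_tensor n X)) (norm_dist Y)
      (decomposable_restriction n X Y T) L"
  then show "operator_norm (projective_tensor n X) Y (linearization n X Y T) \<le> L"
    unfolding multilinear_norm_eq_operator_norm[OF b, symmetric]
    by (intro multilinear_norm_le unit_bound_if_lipschitz_const)
qed

end

end

section \<open>The equivalences and the equality of the norms\<close>

theorem theorem3p2:
  fixes n :: nat
    and X :: "nat \<Rightarrow> ('k::real_normed_field, 'a) nspace"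
    and Y :: "('k, 'b) nspace"
    and T :: "(nat \<Rightarrow> 'a) \<Rightarrow> 'b"
  assumes n: "n \<ge> 1"
    and X: "\<And>i. i \<in> {1..n} \<Longrightarrow> carrier_banach_space (X i)"
    and Y: "carrier_banach_space Y"
    and T: "multilinear_map n X Y T"
  defines "P \<equiv> projective_tensor n X"
    and "T_hat \<equiv> linearization n X Y T"
    and "f_T \<equiv> decomposable_restriction n X Y T"
    and "S \<equiv> decomposable_tensors n X"
  shows "(bounded_multilinear_map n X Y T \<longleftrightarrow> bounded_linear_map P Y T_hat)
    \<and> (bounded_linear_map P Y T_hat \<longleftrightarrow>
        (\<exists>F. bounded_linear_map (norm_completion P) Y F \<and> extends_to_completion P T_hat F))
    \<and> (bounded_multilinear_map n X Y T \<longleftrightarrow>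
        (\<exists>L. lipschitz_const S (norm_dist P) (norm_dist Y) f_T L))
    \<and> (bounded_multilinear_map n X Y T \<longrightarrow>
        multilinear_norm n X Y T = operator_norm P Y T_hat
        \<and> operator_norm P Y T_hat = lipschitz_norm S (norm_dist P) (norm_dist Y) f_T
        \<and> (\<forall>F. bounded_linear_map (norm_completion P) Y F \<and> extends_to_completion P T_hat F
              \<longrightarrow> operator_norm (norm_completion P) Y F = operator_norm P Y T_hat))"
proof -
  interpret Y: carrier_banach_space Y by (rule Y)
  interpret normed_tensor_spaces n X
    using n carrier_banach_space.axioms(1)[OF X] by (rule normed_tensor_spaces.intro)
  interpret P: carrier_seminormed_space P
    unfolding P_def by (rule carrier_seminormed_space_projective_tensor)
  note YT = Y.carrier_normed_space_axioms T
  have 1: "bounded_multilinear_map n X Y T \<longleftrightarrow> bounded_linear_map P Y T_hat"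
    unfolding P_def T_hat_def
    using bounded_linear_map_linearization[OF YT] bounded_multilinear_map_if_linearization[OF YT] by blast
  have 2: "bounded_linear_map P Y T_hat \<longleftrightarrow>
      (\<exists>F. bounded_linear_map (norm_completion P) Y F \<and> extends_to_completion P T_hat F)"
    using P.extension_exists[OF _ Y] P.bounded_linear_map_if_extension linear_map_projective_linearization[OF YT]
    unfolding P_def T_hat_def by blast
  have 3: "bounded_multilinear_map n X Y T \<longleftrightarrow>
      (\<exists>L. lipschitz_const S (norm_dist P) (norm_dist Y) f_T L)"
    using 1 lipschitz_const_operator_norm[OF YT] bounded_multilinear_map_if_lipschitz_const[OF YT]
    unfolding P_def T_hat_def f_T_def S_def by blast
  have 4: "multilinear_norm n X Y T = operator_norm P Y T_hat"
    "operator_norm P Y T_hat = lipschitz_norm S (norm_dist P) (norm_dist Y) f_T"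
    if "bounded_multilinear_map n X Y T"
    unfolding P_def T_hat_def f_T_def S_def
    using multilinear_norm_eq_operator_norm[OF YT that] lipschitz_norm_eq_operator_norm[OF YT that]
    by simp_all
  have 5: "operator_norm (norm_completion P) Y F = operator_norm P Y T_hat"
    if "bounded_multilinear_map n X Y T" "bounded_linear_map (norm_completion P) Y F"
      "extends_to_completion P T_hat F" for F
    using P.operator_norm_extension[OF that(2,3) _ Y.carrier_seminormed_space_axioms] 1 that(1)
    by blast
  show ?thesis
    using 1 2 3 4 5 by blast
qed

end
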